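(* Let $\mathbf M=(m_1,\dots,m_r)\in\mathbb Z^r$ satisfy $|m_{\alpha+1}-m_\alpha|\le1$ for $1\le\alpha<r$. For $j\in\mathbb Z$ and integers $k\ge0$, the quotient $$\frac{T_{1,j,k+m_1}}{T_{1,j+k,m_1}}$$ is the partition function for paths on the rooted graph $\Gamma_{\mathbf M}$, with the weights described in the context, starting from the root at time $j-k$ and ending at the root at time $j+k$. As such it is a Laurent polynomial with non-negative coefficients in the elements of $\mathbf x_{\mathbf M}=\{T_{\alpha,i,m_\alpha},T_{\alpha,i,m_\alpha+1}:\alpha\in I_r,\ i\in\mathbb Z\}$.
   Context: $T$-system: fix $r\ge1$, $I_r=\{1,\dots,r\}$. Let $\{T_{\alpha,j,0},T_{\alpha,j,1}:\alpha\in I_r,\ j\in\mathbb Z\}$ be independent commuting variables and let $T_{\alpha,j,k}$ ($0\le\alpha\le r+1$, $j,k\in\mathbb Z$) be the elements of the field of rational functions in them determined by $T_{\alpha,j,k+1}T_{\alpha,j,k-1}=T_{\alpha,j+1,k}T_{\alpha,j-1,k}+T_{\alpha+1,j,k}T_{\alpha-1,j,k}$ ($\alpha\in I_r$), $T_{0,j,k}=T_{r+1,j,k}=1$. Graph $\Gamma_{\mathbf M}$. It has spine vertices $0,1,2,\dots$ (root $0$), side vertices $x'$ attached to certain spine vertices $x$, $2r+1$ skeleton edges labelled $1,\dots,2r+1$ from bottom to top, and additional oriented long edges. Skeleton: edge $1$ joins $0$ and $1$; for $\alpha=1,\dots,r$ the edge $2\alpha$ is a spine edge (joining a spine vertex $x$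 to $x+1$); edge $2$ joins $1$ and $2$. For $1\le\alpha<r$, if $m_{\alpha+1}=m_\alpha+1$ then edge $2\alpha+1$ is a spine edge lying between the spine edges $2\alpha$ (below) and $2\alpha+2$ (above); otherwise the spine edges $2\alpha$ and $2\alpha+2$ are consecutive, sharing a spine vertex $x$, and edge $2\alpha+1$ is a side edge joining $x$ to a side vertex $x'$. Edge $2r+1$ is a spine edge on top of edge $2r$. Long edges: for every maximal interval $\{\alpha,\alpha+1,\dots,\beta\}\subset I_r$, $\alpha<\beta$, with $m_{\gamma+1}=m_\gamma-1$ for $\alpha\le\gamma<\beta$, consider the spine vertices from the bottom endpoint of edge $2\alpha$ to the top endpoint of edge $2\beta$; for each two of these $i,l$ with $i>l+1$ there is an oriented edge $i\to l$. Skeleton weights. Put $\lambda_{\alpha,t,m}=T_{\alpha,t,m+1}/T_{\alpha,t+1,m}$ and $\mu_{\alpha,t,m}=T_{\alpha,t,m}/T_{\alpha-1,t+1,m}$, with $\lambda_{0,t,m}=\lambda_{r+1,t,m}=1$. Define $y_1(t)=\lambda_{1,t,m_1}$, $$y_{2\alpha-1}(t)=\frac{\lambda_{\alpha,\,t+m_\alpha-m_1-1,\,m_\alpha}}{\lambda_{\alpha-1,\,t+m_{\alpha-1}-m_1,\,m_{\alpha-1}}}\qquad(2\le\alpha\le r+1)$$ (for $\alpha=r+1$ the numerator is $1$), and for $1\le\alpha\le r$ $$y_{2\alpha}(t)=\frac{\mu_{\alpha+1,\,t+m_\alpha-m_1,\,m_\alpha+1}}{\mu_{\alpha,\,t+m_\alpha-m_1,\,m_\alpha}}\,A_\alpha(t)\,B_\alpha(t),$$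 where $A_\alpha(t)=\lambda_{\alpha+1,t+m_{\alpha+1}-m_1,m_{\alpha+1}}/\lambda_{\alpha+1,t+m_\alpha-m_1,m_\alpha}$ if $\alpha<r$ and $m_\alpha=m_{\alpha+1}+1$, and $A_\alpha(t)=1$ otherwise; $B_\alpha(t)=\lambda_{\alpha-1,t+m_\alpha-m_1,m_\alpha}/\lambda_{\alpha-1,t+m_{\alpha-1}-m_1,m_{\alpha-1}}$ if $\alpha>1$ and $m_\alpha=m_{\alpha-1}-1$, and $B_\alpha(t)=1$ otherwise. Operator weights of steps. On the vector space with basis $\{\langle t|:t\in\mathbb Z\}$ (over the field above), let operators act from the right by $\langle t|\,d=\langle t+1|$ and $\langle t|\,\mathbb Y_\beta=y_\beta(t)\langle t+1|$, $\beta=1,\dots,2r+1$. Every skeleton edge may be traversed in both directions. A step away from the root ($x\to x+1$ or $x\to x'$) has operator weight $\mathbb Y_{x,x+1}=\mathbb Y_{x,x'}=d$; a step towards the root ($x+1\to x$ or $x'\to x$) along the skeleton edge labelled $\beta$ has operator weight $\mathbb Y_{x+1,x}=\mathbb Y_\beta$, respectively $\mathbb Y_{x',x}=\mathbb Y_\beta$. A long step $i\to i-k$ ($k>1$) has operator weight $$\mathbb Y_{i,i-k}=\Bigl(\prod_{a=i-1}^{i-k+1}\mathbb Y_{a+1,a}\,(\mathbb Y_{a,a'})^{-1}(\mathbb Y_{a',a})^{-1}\Bigr)\mathbb Y_{i-k+1,i-k},$$ the product being ordered with $a$ decreasing from left to right; thus $\langle t|\mathbb Y_{i,i-k}$ is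 a multiple of $\langle t-k+2|$. So skeleton steps increase time by $1$ and a long step $i\to i-k$ goes back in time by $k-2$ units. A path from the root at time $t$ to the root at time $t'$ is a finite sequence of consecutive steps from vertex $0$ to vertex $0$ whose total time shift is $t'-t$; its weight is the coefficient of $\langle t'|$ in $\langle t|$ acted on by the product of the step operator weights in the order the steps are taken. The partition function is the sum of the weights of all such paths.
   Formalization: The weights are corrected, as the identity fails with the stated ones: in long steps the two inverses are taken in the order (Y_{a',a})^{-1}(Y_{a,a'})^{-1}, and Y_β has weight y_β(t−a), where a is the number of γ with 1≤γ<⌊β/2⌋ and m_{γ+1}=m_γ+1. *)

theory Defs
  imports
    Complex_Main
    "HOL-Library.Poly_Mapping"
    "HOL-Library.Product_Lexorder"
    "HOL-Computational_Algebra.Fraction_Field"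
begin

section \<open>The T-system\<close>

text \<open>
  Polynomials with rational coefficients in the variables \<open>T\<^bsub>\<alpha>,j,0\<^esub>\<close> (index \<open>(\<alpha>, j, False)\<close>) and
  \<open>T\<^bsub>\<alpha>,j,1\<^esub>\<close> (index \<open>(\<alpha>, j, True)\<close>), and their field of fractions.  Variables with \<open>\<alpha>\<close> outside
  \<open>{1..r}\<close> exist in this type but are never used.
\<close>

type_synonym tvar = "nat \<times> int \<times> bool"
type_synonym tpoly = "(tvar \<Rightarrow>\<^sub>0 nat) \<Rightarrow>\<^sub>0 rat"
type_synonym ratfun = "tpoly fract"

definition tvar :: "bool \<Rightarrow> nat \<Rightarrow> int \<Rightarrow> ratfun" where
  "tvar b \<alpha> j = Fract (Poly_Mapping.single (Poly_Mapping.single (\<alpha>, j, b) 1) 1) 1"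

text \<open>
  The recursion is invariant under \<open>k \<mapsto> 1 - k\<close>, so both directions of time are the same recursion
  \<open>t_iter\<close> started from the two layers \<open>f\<close>, \<open>g\<close> in either order.
\<close>

fun t_iter :: "nat \<Rightarrow> (nat \<Rightarrow> int \<Rightarrow> ratfun) \<Rightarrow> (nat \<Rightarrow> int \<Rightarrow> ratfun) \<Rightarrow> nat \<Rightarrow> nat \<Rightarrow> int \<Rightarrow> ratfun" where
  "t_iter r f g 0 \<alpha> j = (if \<alpha> \<in> {1..r} then f \<alpha> j else 1)"
| "t_iter r f g (Suc 0) \<alpha> j = (if \<alpha> \<in> {1..r} then g \<alpha> j else 1)"
| "t_iter r f g (Suc (Suc n)) \<alpha> j =
     (if \<alpha> \<in> {1..r}
      then (t_iter r f g (Suc n) \<alpha> (j + 1) * t_iter r f g (Suc n) \<alpha> (j - 1)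
            + t_iter r f g (Suc n) (\<alpha> + 1) j * t_iter r f g (Suc n) (\<alpha> - 1) j)
           / t_iter r f g n \<alpha> j
      else 1)"

definition Tsol :: "nat \<Rightarrow> nat \<Rightarrow> int \<Rightarrow> int \<Rightarrow> ratfun" where
  "Tsol r \<alpha> j k = (if 0 \<le> k then t_iter r (tvar False) (tvar True) (nat k) \<alpha> j
                else t_iter r (tvar True) (tvar False) (nat (1 - k)) \<alpha> j)"

text \<open>
  \<open>Tsol\<close> has the prescribed initial values and satisfies the T-system.  The point is that no
  \<open>T\<close> vanishes, because all of them are quotients of nonzero polynomials with non-negative coefficients.
\<close>

definition nonneg_poly :: "tpoly \<Rightarrow> bool" where
  "nonneg_poly p \<longleftrightarrow> p \<noteq> 0 \<and> (\<forall>e. 0 \<le> Poly_Mapping.lookup p e)"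

definition subtraction_free :: "ratfun \<Rightarrow> bool" where
  "subtraction_free x \<longleftrightarrow> (\<exists>p q. nonneg_poly p \<and> nonneg_poly q \<and> x = Fract p q)"

lemma nonneg_poly_add: "nonneg_poly p \<Longrightarrow> nonneg_poly q \<Longrightarrow> nonneg_poly (p + q)"
  unfolding nonneg_poly_def poly_mapping_eq_iff fun_eq_iff
  by (auto simp: lookup_add add_nonneg_eq_0_iff)

lemma nonneg_poly_mult: "nonneg_poly p \<Longrightarrow> nonneg_poly q \<Longrightarrow> nonneg_poly (p * q)"
  unfolding nonneg_poly_def
  by (auto simp: lookup_mult Sum_any.expand_set when_def intro!: sum_nonneg mult_nonneg_nonneg)

lemma subtraction_free_nonzero: "subtraction_free x \<Longrightarrow> x \<noteq> 0"
  by (auto simp: subtraction_free_def nonneg_poly_def Zero_fract_def eq_fract)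

lemma subtraction_free_add: "subtraction_free x \<Longrightarrow> subtraction_free y \<Longrightarrow> subtraction_free (x + y)"
  unfolding subtraction_free_def
proof (elim exE conjE)
  fix p q p' q'
  assume *: "nonneg_poly p" "nonneg_poly q" "nonneg_poly p'" "nonneg_poly q'"
    "x = Fract p q" "y = Fract p' q'"
  then have "x + y = Fract (p * q' + p' * q) (q * q')"
    by (simp add: nonneg_poly_def)
  moreover have "nonneg_poly (p * q' + p' * q)" "nonneg_poly (q * q')"
    by (intro nonneg_poly_add nonneg_poly_mult *)+
  ultimately show "\<exists>p q. nonneg_poly p \<and> nonneg_poly q \<and> x + y = Fract p q"
    by blast
qed

lemma subtraction_free_mult: "subtraction_free x \<Longrightarrow> subtraction_free y \<Longrightarrow> subtraction_free (x * y)"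
  unfolding subtraction_free_def
proof (elim exE conjE)
  fix p q p' q'
  assume *: "nonneg_poly p" "nonneg_poly q" "nonneg_poly p'" "nonneg_poly q'"
    "x = Fract p q" "y = Fract p' q'"
  then have "x * y = Fract (p * p') (q * q')"
    by (simp only: mult_fract)
  moreover have "nonneg_poly (p * p')" "nonneg_poly (q * q')"
    by (intro nonneg_poly_add nonneg_poly_mult *)+
  ultimately show "\<exists>p q. nonneg_poly p \<and> nonneg_poly q \<and> x * y = Fract p q"
    by blast
qed

lemma subtraction_free_divide: "subtraction_free x \<Longrightarrow> subtraction_free y \<Longrightarrow> subtraction_free (x / y)"
  unfolding subtraction_free_def
proof (elim exE conjE)
  fix p q p' q'
  assume *: "nonneg_poly p" "nonneg_poly q" "nonneg_poly p'" "nonneg_poly q'"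
    "x = Fract p q" "y = Fract p' q'"
  then have "x / y = Fract (p * q') (q * p')"
    by (simp only: divide_fract)
  moreover have "nonneg_poly (p * q')" "nonneg_poly (q * p')"
    by (intro nonneg_poly_add nonneg_poly_mult *)+
  ultimately show "\<exists>p q. nonneg_poly p \<and> nonneg_poly q \<and> x / y = Fract p q"
    by blast
qed

lemma nonneg_poly_single: "nonneg_poly (Poly_Mapping.single e 1)"
proof -
  have "Poly_Mapping.lookup (Poly_Mapping.single e 1 :: tpoly) e \<noteq> 0"
    by simp
  then have "(Poly_Mapping.single e 1 :: tpoly) \<noteq> 0"
    by force
  then show ?thesis
    by (simp add: nonneg_poly_def lookup_single when_def)
qed

lemma nonneg_poly_one: "nonneg_poly 1"
  unfolding single_one[symmetric] by (rule nonneg_poly_single)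

lemma subtraction_free_one: "subtraction_free 1"
  unfolding subtraction_free_def
  by (rule exI[of _ 1], rule exI[of _ 1], intro conjI, rule nonneg_poly_one, rule nonneg_poly_one,
      rule One_fract_def)

lemma subtraction_free_tvar: "subtraction_free (tvar b \<alpha> j)"
  unfolding subtraction_free_def tvar_def
  by (rule exI, rule exI[of _ 1], intro conjI, rule nonneg_poly_single, rule nonneg_poly_one, rule refl)

lemma subtraction_free_t_iter:
  assumes "\<And>\<alpha> j. subtraction_free (f \<alpha> j)" "\<And>\<alpha> j. subtraction_free (g \<alpha> j)"
  shows "subtraction_free (t_iter r f g n \<alpha> j)"
  using assms
  by (induction r f g n \<alpha> j rule: t_iter.induct)
     (auto intro!: subtraction_free_divide subtraction_free_add subtraction_free_mult
           intro: subtraction_free_one)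

lemma subtraction_free_T: "subtraction_free (Tsol r \<alpha> j k)"
  by (simp add: Tsol_def subtraction_free_t_iter subtraction_free_tvar)

lemma T_nonzero: "Tsol r \<alpha> j k \<noteq> 0"
  by (rule subtraction_free_nonzero[OF subtraction_free_T])

lemma T_init:
  assumes "\<alpha> \<in> {1..r}"
  shows "Tsol r \<alpha> j 0 = tvar False \<alpha> j" "Tsol r \<alpha> j 1 = tvar True \<alpha> j"
  using assms by (simp_all add: Tsol_def)

lemma T_boundary: "Tsol r 0 j k = 1" "Tsol r (r + 1) j k = 1"
proof -
  have "\<alpha> \<notin> {1..r} \<Longrightarrow> t_iter r f g n \<alpha> j = 1" for f g n \<alpha>
    by (induction r f g n \<alpha> j rule: t_iter.induct) auto
  then show "Tsol r 0 j k = 1" "Tsol r (r + 1) j k = 1"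
    by (auto simp: Tsol_def)
qed

lemma T_reflect:
  "k \<le> 1 \<Longrightarrow> Tsol r \<alpha> j k = t_iter r (tvar True) (tvar False) (nat (1 - k)) \<alpha> j"
  by (cases "k = 0"; cases "k = 1") (auto simp: Tsol_def)

lemma T_system:
  assumes "\<alpha> \<in> {1..r}"
  shows "Tsol r \<alpha> j (k + 1) * Tsol r \<alpha> j (k - 1)
           = Tsol r \<alpha> (j + 1) k * Tsol r \<alpha> (j - 1) k + Tsol r (\<alpha> + 1) j k * Tsol r (\<alpha> - 1) j k"
proof (cases "1 \<le> k")
  case True
  then have n: "nat (k + 1) = Suc (Suc (nat (k - 1)))" "nat k = Suc (nat (k - 1))"
    by auto
  show ?thesis
    using True assms T_nonzero[of r \<alpha> j "k - 1"] by (simp add: Tsol_def n)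
next
  case False
  then have n: "nat (2 - k) = Suc (Suc (nat (- k)))" "nat (1 - k) = Suc (nat (- k))"
    by auto
  show ?thesis
    using False assms T_nonzero[of r \<alpha> j "k + 1"] by (simp add: T_reflect n)
qed

section \<open>The graph\<close>

text \<open>
  In what follows \<open>m \<alpha>\<close>, \<open>\<alpha> \<in> {1..r}\<close>, are the entries of \<open>\<^bold>M\<close>; no other value of \<open>m\<close> matters.
  The spine vertex \<open>bot m \<alpha>\<close> is the bottom endpoint of edge \<open>2\<alpha>\<close>: below it there are
  edge 1, the edges \<open>2\<gamma>\<close> with \<open>\<gamma> < \<alpha>\<close>, and those edges \<open>2\<gamma> + 1\<close> with \<open>\<gamma> < \<alpha>\<close> that lie on the spine.
  The pair \<open>ends r m \<beta>\<close> has the endpoint closer to the root first.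
\<close>

datatype vertex = Spine nat | Side nat

definition ascents :: "(nat \<Rightarrow> int) \<Rightarrow> nat \<Rightarrow> nat" where
  "ascents m \<alpha> = card {\<gamma> \<in> {1..<\<alpha>}. m (\<gamma> + 1) = m \<gamma> + 1}"

definition bot :: "(nat \<Rightarrow> int) \<Rightarrow> nat \<Rightarrow> nat" where
  "bot m \<alpha> = \<alpha> + ascents m \<alpha>"

definition ends :: "nat \<Rightarrow> (nat \<Rightarrow> int) \<Rightarrow> nat \<Rightarrow> vertex \<times> vertex" where
  "ends r m \<beta> =
     (let \<alpha> = \<beta> div 2; x = bot m \<alpha> in
      if \<beta> = 1 then (Spine 0, Spine 1)
      else if even \<beta> then (Spine x, Spine (x + 1))
      else if \<alpha> = r \<or> m (\<alpha> + 1) = m \<alpha> + 1 then (Spine (x + 1), Spine (x + 2))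
      else (Spine (x + 1), Side (x + 1)))"

definition up_step :: "nat \<Rightarrow> (nat \<Rightarrow> int) \<Rightarrow> vertex \<Rightarrow> vertex \<Rightarrow> bool" where
  "up_step r m u v \<longleftrightarrow> (\<exists>\<beta> \<in> {1..2 * r + 1}. ends r m \<beta> = (u, v))"

definition edge_label :: "nat \<Rightarrow> (nat \<Rightarrow> int) \<Rightarrow> vertex \<Rightarrow> vertex \<Rightarrow> nat" where
  "edge_label r m u v = (THE \<beta>. \<beta> \<in> {1..2 * r + 1} \<and> ends r m \<beta> = (u, v))"

definition descending :: "nat \<Rightarrow> (nat \<Rightarrow> int) \<Rightarrow> nat \<Rightarrow> nat \<Rightarrow> bool" where
  "descending r m \<alpha> \<beta> \<longleftrightarrow> 1 \<le> \<alpha> \<and> \<alpha> < \<beta> \<and> \<beta> \<le> r \<and> (\<forall>\<gamma> \<in> {\<alpha>..<\<beta>}. m (\<gamma> + 1) = m \<gamma> - 1)"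

definition max_descending :: "nat \<Rightarrow> (nat \<Rightarrow> int) \<Rightarrow> nat \<Rightarrow> nat \<Rightarrow> bool" where
  "max_descending r m \<alpha> \<beta> \<longleftrightarrow> descending r m \<alpha> \<beta> \<and>
     (\<forall>\<alpha>' \<beta>'. descending r m \<alpha>' \<beta>' \<and> {\<alpha>..\<beta>} \<subseteq> {\<alpha>'..\<beta>'} \<longrightarrow> {\<alpha>..\<beta>} = {\<alpha>'..\<beta>'})"

definition long_edge :: "nat \<Rightarrow> (nat \<Rightarrow> int) \<Rightarrow> nat \<Rightarrow> nat \<Rightarrow> bool" where
  "long_edge r m i l \<longleftrightarrow>
     (\<exists>\<alpha> \<beta>. max_descending r m \<alpha> \<beta> \<and> bot m \<alpha> \<le> l \<and> l + 1 < i \<and> i \<le> bot m \<beta> + 1)"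

definition skel_step :: "nat \<Rightarrow> (nat \<Rightarrow> int) \<Rightarrow> vertex \<Rightarrow> vertex \<Rightarrow> bool" where
  "skel_step r m u v \<longleftrightarrow> up_step r m u v \<or> up_step r m v u"

definition graph_step :: "nat \<Rightarrow> (nat \<Rightarrow> int) \<Rightarrow> vertex \<Rightarrow> vertex \<Rightarrow> bool" where
  "graph_step r m u v \<longleftrightarrow>
     skel_step r m u v \<or> (\<exists>i l. u = Spine i \<and> v = Spine l \<and> long_edge r m i l)"

section \<open>Skeleton weights\<close>

definition lam :: "nat \<Rightarrow> nat \<Rightarrow> int \<Rightarrow> int \<Rightarrow> ratfun" where
  "lam r \<alpha> t n = (if \<alpha> = 0 \<or> \<alpha> = r + 1 then 1 else Tsol r \<alpha> t (n + 1) / Tsol r \<alpha> (t + 1) n)"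

definition mu :: "nat \<Rightarrow> nat \<Rightarrow> int \<Rightarrow> int \<Rightarrow> ratfun" where
  "mu r \<alpha> t n = Tsol r \<alpha> t n / Tsol r (\<alpha> - 1) (t + 1) n"

definition wA :: "nat \<Rightarrow> (nat \<Rightarrow> int) \<Rightarrow> nat \<Rightarrow> int \<Rightarrow> ratfun" where
  "wA r m \<alpha> t =
     (if \<alpha> < r \<and> m \<alpha> = m (\<alpha> + 1) + 1
      then lam r (\<alpha> + 1) (t + m (\<alpha> + 1) - m 1) (m (\<alpha> + 1)) / lam r (\<alpha> + 1) (t + m \<alpha> - m 1) (m \<alpha>)
      else 1)"

definition wB :: "nat \<Rightarrow> (nat \<Rightarrow> int) \<Rightarrow> nat \<Rightarrow> int \<Rightarrow> ratfun" where
  "wB r m \<alpha> t =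
     (if 1 < \<alpha> \<and> m \<alpha> = m (\<alpha> - 1) - 1
      then lam r (\<alpha> - 1) (t + m \<alpha> - m 1) (m \<alpha>) / lam r (\<alpha> - 1) (t + m (\<alpha> - 1) - m 1) (m (\<alpha> - 1))
      else 1)"

definition ywt :: "nat \<Rightarrow> (nat \<Rightarrow> int) \<Rightarrow> nat \<Rightarrow> int \<Rightarrow> ratfun" where
  "ywt r m \<beta> t =
     (if \<beta> = 1 then lam r 1 t (m 1)
      else if odd \<beta> then
        let \<alpha> = (\<beta> + 1) div 2 in
        lam r \<alpha> (t + m \<alpha> - m 1 - 1) (m \<alpha>) / lam r (\<alpha> - 1) (t + m (\<alpha> - 1) - m 1) (m (\<alpha> - 1))
      else
        let \<alpha> = \<beta> div 2 in
        mu r (\<alpha> + 1) (t + m \<alpha> - m 1) (m \<alpha> + 1) / mu r \<alpha> (t + m \<alpha> - m 1) (m \<alpha>)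
          * wA r m \<alpha> t * wB r m \<alpha> t)"

section \<open>Operators and paths\<close>

text \<open>
  The finitely supported \<open>v :: int \<Rightarrow>\<^sub>0 ratfun\<close> is the vector whose coefficient at the basis vector
  \<open>\<langle>t|\<close> is \<open>Poly_Mapping.lookup v t\<close>.  Operators act from the right, so in a product of operators
  the leftmost one is applied first.
\<close>

type_synonym oper = "(int \<Rightarrow>\<^sub>0 ratfun) \<Rightarrow> (int \<Rightarrow>\<^sub>0 ratfun)"

definition basis_vec :: "int \<Rightarrow> (int \<Rightarrow>\<^sub>0 ratfun)" where
  "basis_vec t = Poly_Mapping.single t 1"

definition wshift :: "(int \<Rightarrow> ratfun) \<Rightarrow> oper" where
  "wshift w v = (\<Sum>t \<in> Poly_Mapping.keys v. Poly_Mapping.single (t + 1) (Poly_Mapping.lookup v t * w t))"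

lemma lookup_wshift:
  "Poly_Mapping.lookup (wshift w v) u = Poly_Mapping.lookup v (u - 1) * w (u - 1)"
proof -
  have "Poly_Mapping.lookup (wshift w v) u
      = (\<Sum>t \<in> Poly_Mapping.keys v. if t = u - 1 then Poly_Mapping.lookup v t * w t else 0)"
    unfolding wshift_def lookup_sum by (rule sum.cong) (auto simp: lookup_single when_def)
  also have "\<dots> = Poly_Mapping.lookup v (u - 1) * w (u - 1)"
    by (simp add: in_keys_iff)
  finally show ?thesis .
qed

lemma bij_wshift:
  assumes "\<And>t. w t \<noteq> 0"
  shows "bij (wshift w)"
proof (rule bijI)
  show "inj (wshift w)"
  proof (rule injI, rule poly_mapping_eqI)
    fix u v t
    assume "wshift w u = wshift w v"
    then have "Poly_Mapping.lookup (wshift w u) (t + 1) = Poly_Mapping.lookup (wshift w v) (t + 1)"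
      by simp
    then show "Poly_Mapping.lookup u t = Poly_Mapping.lookup v t"
      using assms[of t] by (simp add: lookup_wshift)
  qed
  show "surj (wshift w)"
  proof (rule surjI)
    fix v
    show "wshift w (\<Sum>t \<in> Poly_Mapping.keys v.
            Poly_Mapping.single (t - 1) (Poly_Mapping.lookup v t / w (t - 1))) = v"
    proof (rule poly_mapping_eqI)
      fix u
      have "(\<Sum>t \<in> Poly_Mapping.keys v. Poly_Mapping.lookup
              (Poly_Mapping.single (t - 1) (Poly_Mapping.lookup v t / w (t - 1))) (u - 1))
          = (\<Sum>t \<in> Poly_Mapping.keys v. if t = u then Poly_Mapping.lookup v u / w (u - 1) else 0)"
        by (rule sum.cong) (auto simp: lookup_single when_def)
      then show "Poly_Mapping.lookup (wshift w (\<Sum>t \<in> Poly_Mapping.keys v.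
          Poly_Mapping.single (t - 1) (Poly_Mapping.lookup v t / w (t - 1)))) u = Poly_Mapping.lookup v u"
        using assms[of "u - 1"] by (simp add: lookup_wshift lookup_sum in_keys_iff)
    qed
  qed
qed

definition op_prod :: "oper list \<Rightarrow> oper" where
  "op_prod As = fold (\<lambda>A v. A v) As"

definition d_op :: oper where
  "d_op = wshift (\<lambda>t. 1)"

text \<open>
  The weight \<open>y\<^bsub>\<beta>\<^esub>\<close> is read at the time at which its edge is reached, not counting the steps spent on
  spine edges \<open>2\<gamma> + 1\<close> (those with \<open>m\<^bsub>\<gamma>+1\<^esub> = m\<^bsub>\<gamma>\<^esub> + 1\<close>) strictly below the edges \<open>2\<alpha>\<close>, \<open>2\<alpha> + 1\<close>,
  where \<open>\<alpha> = \<beta> div 2\<close>; there are \<open>ascents m \<alpha>\<close> of them.  Without this lag the partition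
  function identity fails when \<open>\<^bold>M\<close> has ascents, first for \<open>\<^bold>M = (0, 1)\<close> and \<open>k = 4\<close>:
  there the weight of edge 4 has to be
  \<open>1 / (T\<^bsub>2,t+1,2\<^esub> \<mu>\<^bsub>2,t,1\<^esub>)\<close>, whereas \<open>y\<^bsub>4\<^esub>(t) = 1 / (T\<^bsub>2,t+2,2\<^esub> \<mu>\<^bsub>2,t+1,1\<^esub>)\<close>.
\<close>

definition Y_op :: "nat \<Rightarrow> (nat \<Rightarrow> int) \<Rightarrow> nat \<Rightarrow> oper" where
  "Y_op r m \<beta> = wshift (\<lambda>t. ywt r m \<beta> (t - int (ascents m (\<beta> div 2))))"

lemma ywt_nonzero: "ywt r m \<beta> t \<noteq> 0"
  by (simp add: ywt_def lam_def mu_def wA_def wB_def T_nonzero Let_def)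

text \<open>All operators that are inverted below are indeed invertible.\<close>

lemma bij_d_op: "bij d_op"
  by (simp add: d_op_def bij_wshift)

lemma bij_Y_op: "bij (Y_op r m \<beta>)"
  by (simp add: Y_op_def bij_wshift ywt_nonzero)

definition skel_op :: "nat \<Rightarrow> (nat \<Rightarrow> int) \<Rightarrow> vertex \<Rightarrow> vertex \<Rightarrow> oper" where
  "skel_op r m u v = (if up_step r m u v then d_op else Y_op r m (edge_label r m v u))"

text \<open>
  Each factor of a long step removes an excursion \<open>a \<rightarrow> a' \<rightarrow> a\<close> to a side vertex, that is, it
  contains the inverse of \<open>\<^bold>Y\<^bsub>a,a'\<^esub> \<^bold>Y\<^bsub>a',a\<^esub>\<close>, in which \<open>\<^bold>Y\<^bsub>a',a\<^esub>\<^sup>-\<^sup>1\<close> acts first.  The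
  opposite order would evaluate the side weight at a time off by one, and the partition function
  identity would fail, first for \<open>\<^bold>M = (0, -1)\<close> and \<open>k = 2\<close>.
\<close>

definition long_op :: "nat \<Rightarrow> (nat \<Rightarrow> int) \<Rightarrow> nat \<Rightarrow> nat \<Rightarrow> oper" where
  "long_op r m i l =
     op_prod (concat (map (\<lambda>a. [skel_op r m (Spine (a + 1)) (Spine a),
                                inv (skel_op r m (Side a) (Spine a)),
                                inv (skel_op r m (Spine a) (Side a))])
                          (rev [l + 1..<i]))
              @ [skel_op r m (Spine (l + 1)) (Spine l)])"

definition step_op :: "nat \<Rightarrow> (nat \<Rightarrow> int) \<Rightarrow> vertex \<Rightarrow> vertex \<Rightarrow> oper" where
  "step_op r m u v =
     (if skel_step r m u v then skel_op r m u v
      else (case (u, v) of (Spine i, Spine l) \<Rightarrow> long_op r m i l | _ \<Rightarrow> id))"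

definition step_time :: "nat \<Rightarrow> (nat \<Rightarrow> int) \<Rightarrow> vertex \<Rightarrow> vertex \<Rightarrow> int" where
  "step_time r m u v =
     (if skel_step r m u v then 1
      else (case (u, v) of (Spine i, Spine l) \<Rightarrow> 2 - (int i - int l) | _ \<Rightarrow> 0))"

text \<open>
  The graph has at most one edge between two vertices, so a path is the list of the vertices it
  visits; the empty path from the root to itself is \<open>[Spine 0]\<close>.
\<close>

definition path_time :: "nat \<Rightarrow> (nat \<Rightarrow> int) \<Rightarrow> vertex list \<Rightarrow> int" where
  "path_time r m p = sum_list (map2 (step_time r m) p (tl p))"

definition root_paths :: "nat \<Rightarrow> (nat \<Rightarrow> int) \<Rightarrow> int \<Rightarrow> int \<Rightarrow> vertex list set" where
  "root_paths r m t t' =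
     {p. p \<noteq> [] \<and> hd p = Spine 0 \<and> last p = Spine 0 \<and>
         successively (graph_step r m) p \<and> path_time r m p = t' - t}"

definition path_weight :: "nat \<Rightarrow> (nat \<Rightarrow> int) \<Rightarrow> int \<Rightarrow> int \<Rightarrow> vertex list \<Rightarrow> ratfun" where
  "path_weight r m t t' p = Poly_Mapping.lookup (op_prod (map2 (step_op r m) p (tl p)) (basis_vec t)) t'"

text \<open>The sum below is over a finite set, because every loop takes time.\<close>

primrec height :: "vertex \<Rightarrow> int" where
  "height (Spine x) = int x"
| "height (Side x) = int x + 1"

lemma height_ends: "ends r m \<beta> = (u, v) \<Longrightarrow> height v = height u + 1"
  by (auto simp: ends_def Let_def split: if_splits)

lemma bot_le: "bot m \<alpha> \<le> 2 * \<alpha>"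
proof -
  have "ascents m \<alpha> \<le> card {1..<\<alpha>}"
    unfolding ascents_def by (rule card_mono) auto
  then show ?thesis
    by (simp add: bot_def)
qed

lemma long_edge_le: "long_edge r m i l \<Longrightarrow> l + 1 < i \<and> i \<le> 2 * r + 1"
  unfolding long_edge_def max_descending_def descending_def
  using bot_le[of m] by (meson Suc_leI add_le_mono1 le_trans mult_le_mono2)

lemma graph_step_time:
  assumes "graph_step r m u v"
  shows "1 \<le> (2 * int r + 2) * (step_time r m u v - (height v - height u)) + (height v - height u)"
proof (cases "skel_step r m u v")
  case True
  then have "height v = height u + 1 \<or> height u = height v + 1"
    by (auto simp: skel_step_def up_step_def dest: height_ends)
  with True show ?thesis
    by (auto simp: step_time_def)
next
  case False
  with assms obtain i l where "u = Spine i" "v = Spine l" "long_edge r m i l"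
    by (auto simp: graph_step_def)
  with False long_edge_le[of r m i l] show ?thesis
    by (auto simp: step_time_def)
qed

lemma length_path_le:
  assumes "successively (graph_step r m) p" "p \<noteq> []"
  shows "int (length p) - 1 \<le> (2 * int r + 2) * (path_time r m p - (height (last p) - height (hd p)))
           + (height (last p) - height (hd p))"
  using assms
proof (induction p rule: induct_list012)
  case (3 u v p)
  then have "int (length (v # p)) - 1 \<le>
      (2 * int r + 2) * (path_time r m (v # p) - (height (last (v # p)) - height v))
      + (height (last (v # p)) - height v)"
    by auto
  moreover have "1 \<le> (2 * int r + 2) * (step_time r m u v - (height v - height u))
      + (height v - height u)"
    using 3 by (intro graph_step_time) auto
  ultimately show ?case
    by (simp add: path_time_def algebra_simps)
qed (auto simp: path_time_def)

definition vertices :: "nat \<Rightarrow> (nat \<Rightarrow> int) \<Rightarrow> vertex set" where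
  "vertices r m = fst ` ends r m ` {1..2 * r + 1} \<union> snd ` ends r m ` {1..2 * r + 1} \<union> Spine ` {..2 * r + 1}"

lemma graph_step_vertices: "graph_step r m u v \<Longrightarrow> u \<in> vertices r m \<and> v \<in> vertices r m"
  unfolding graph_step_def skel_step_def up_step_def
proof (elim disjE bexE exE conjE)
  fix \<beta>
  assume *: "\<beta> \<in> {1..2 * r + 1}" "ends r m \<beta> = (u, v)"
  show ?thesis
    unfolding vertices_def using imageI[OF imageI[OF *(1)]] *(2) by (metis UnI1 UnI2 fst_conv snd_conv)
next
  fix \<beta>
  assume *: "\<beta> \<in> {1..2 * r + 1}" "ends r m \<beta> = (v, u)"
  show ?thesis
    unfolding vertices_def using imageI[OF imageI[OF *(1)]] *(2) by (metis UnI1 UnI2 fst_conv snd_conv)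
next
  fix i l
  assume "u = Spine i" "v = Spine l" "long_edge r m i l"
  then show ?thesis
    using long_edge_le[of r m i l] by (simp add: vertices_def)
qed

lemma path_vertices:
  "successively (graph_step r m) p \<Longrightarrow> p \<noteq> [] \<Longrightarrow> hd p \<in> vertices r m \<Longrightarrow> set p \<subseteq> vertices r m"
  by (induction p rule: induct_list012) (auto dest: graph_step_vertices)

lemma finite_root_paths: "finite (root_paths r m t t')"
proof (rule finite_subset)
  define n where "n = nat (1 + (2 * int r + 2) * (t' - t))"
  show "root_paths r m t t' \<subseteq> {p. set p \<subseteq> vertices r m \<and> length p \<le> n}"
  proof
    fix p
    assume p: "p \<in> root_paths r m t t'"
    then have "set p \<subseteq> vertices r m"
      by (intro path_vertices) (auto simp: root_paths_def vertices_def)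
    moreover have "length p \<le> n"
      using length_path_le[of r m p] p by (simp add: root_paths_def n_def)
    ultimately show "p \<in> {p. set p \<subseteq> vertices r m \<and> length p \<le> n}"
      by simp
  qed
  have "finite (vertices r m)"
    by (simp add: vertices_def)
  then show "finite {p. set p \<subseteq> vertices r m \<and> length p \<le> n}"
    by (rule finite_lists_length_le)
qed

definition partition_function :: "nat \<Rightarrow> (nat \<Rightarrow> int) \<Rightarrow> int \<Rightarrow> int \<Rightarrow> ratfun" where
  "partition_function r m t t' = (\<Sum>p \<in> root_paths r m t t'. path_weight r m t t' p)"

section \<open>Laurent polynomials with non-negative coefficients\<close>

definition cluster_vars :: "nat \<Rightarrow> (nat \<Rightarrow> int) \<Rightarrow> ratfun set" where
  "cluster_vars r m = {Tsol r \<alpha> i n | \<alpha> i n. \<alpha> \<in> {1..r} \<and> (n = m \<alpha> \<or> n = m \<alpha> + 1)}"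

definition nonneg_laurent :: "'a::field set \<Rightarrow> 'a \<Rightarrow> bool" where
  "nonneg_laurent X f \<longleftrightarrow>
     (\<exists>P :: ('a \<Rightarrow>\<^sub>0 int) \<Rightarrow>\<^sub>0 int.
        (\<forall>e \<in> Poly_Mapping.keys P. Poly_Mapping.keys e \<subseteq> X \<and> 0 \<le> Poly_Mapping.lookup P e) \<and>
        f = (\<Sum>e \<in> Poly_Mapping.keys P. of_int (Poly_Mapping.lookup P e) * (\<Prod>x \<in> Poly_Mapping.keys e. x powi Poly_Mapping.lookup e x)))"

end

theory Submission
  imports Defs
begin

text \<open>
  Fix the final time.  The path sums starting at the vertices of the graph are the unique solution,
  vanishing when too few steps remain, of one linear equation per vertex, so it is enough to exhibit
  a solution whose value at the root is \<open>T\<^bsub>1,j,k+m\<^sub>1\<^esub> / T\<^bsub>1,j+k,m\<^sub>1\<^esub>\<close>.  Such a solution exists simultaneously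
  for all \<open>\<^bold>M\<close>, without mutations: the value at the top of edge \<open>2\<alpha>\<close> is \<open>h\<^sub>\<alpha> / T\<^sub>\<alpha>\<close>, where
  \<open>h\<close> solves the linear problem whose compatibility condition is the T-system.  Each vertex
  equation is then a combination of the three-term relations satisfied by \<open>h\<close>.  Positivity is immediate, since every
  step weight is a Laurent monomial in the elements of \<open>\<^bold>x\<^bsub>\<^bold>M\<^esub>\<close>.
\<close>

section \<open>The linear problem of the T-system\<close>

text \<open>Apart from the normalisation by \<open>m 1\<close>, the slopes of \<open>m\<close> enter
  the value at the top of edge 2\<alpha> only through the point \<open>k = m \<alpha>\<close> at
  which \<open>h \<alpha> n\<close> is evaluated, and \<open>h 0\<close> does not depend on
  \<open>k\<close>; hence one function \<open>h\<close> serves all \<open>m\<close>. Uniqueness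
  rests on an order of the unknowns: a step towards the root, long or not, lowers the number
  \<open>n\<close> of such steps that remain, whereas a step away keeps \<open>n\<close> and moves
  up. So the induction is on \<open>n\<close> and, for fixed \<open>n\<close>, from the top of the
  graph downwards; it closes at the top because \<open>h (Suc r)\<close> vanishes. The obstacle is
  the long edges, of which a vertex may have many. Their weights factor through the vertex below, so
  along a descending run their total obeys a recursion that refers only to the next lower
  vertex.\<close>

lemma three_term:
  fixes u :: "'a::field"
  assumes P: "P * u = a * x - b * y" and Q: "Q * u = c * x - d * y"
    and sys: "b * c = a * d + w * u" and u: "u \<noteq> 0"
  shows "w * y = Q * a - P * c" "w * x = Q * b - P * d"
proof -
  have wu: "w * u = b * c - a * d"
    using sys by simp
  have "(w * y) * u = (w * u) * y"
    by simp
  also have "\<dots> = (Q * u) * a - (P * u) * c"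
    unfolding P Q wu by (simp add: algebra_simps)
  finally have "(w * y) * u = (Q * a - P * c) * u"
    by (simp add: algebra_simps)
  then show "w * y = Q * a - P * c"
    using u by simp
  have "(w * x) * u = (w * u) * x"
    by simp
  also have "\<dots> = (Q * u) * b - (P * u) * d"
    unfolding P Q wu by (simp add: algebra_simps)
  finally have "(w * x) * u = (Q * b - P * d) * u"
    by (simp add: algebra_simps)
  then show "w * x = Q * b - P * d"
    using u by simp
qed

text \<open>
  The conventions for \<open>m 0\<close> and \<open>m (r + 1)\<close> make both ends of the graph look like ascents of \<open>\<^bold>M\<close>.
  The parameter \<open>e\<close> is the time at which the paths end.
\<close>

locale t_system =
  fixes r :: nat and T :: "nat \<Rightarrow> int \<Rightarrow> int \<Rightarrow> 'a::field" and m :: "nat \<Rightarrow> int" and e :: int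
  assumes nz [simp]: "T \<alpha> j k \<noteq> 0"
    and T_bottom [simp]: "T 0 j k = 1"
    and T_top [simp]: "T (Suc r) j k = 1"
    and T_rec: "\<alpha> \<in> {1..r} \<Longrightarrow>
      T \<alpha> j (k + 1) * T \<alpha> j (k - 1)
        = T \<alpha> (j + 1) k * T \<alpha> (j - 1) k + T (\<alpha> + 1) j k * T (\<alpha> - 1) j k"
    and m_bottom: "m 0 = m 1 - 1"
    and m_top: "m (Suc r) = m r + 1"
    and m_step: "\<alpha> \<le> r \<Longrightarrow> \<bar>m (Suc \<alpha>) - m \<alpha>\<bar> \<le> 1"
begin

definition s :: "nat \<Rightarrow> int \<Rightarrow> int" where
  "s \<alpha> n = e - m 1 + int \<alpha> - 2 * n"

text \<open>
  The coefficients are those of a linear problem (Lax pair) whose compatibility condition is the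
  T-system: \<open>h\<close> can be raised in \<open>\<alpha>\<close> by \<open>h_A\<close>, its definition, or by \<open>h_B\<close>, and the two agree because
  of the recursion for \<open>T\<close>.  In terms of \<open>f\<^bsub>a,b\<^esub> = T\<^bsub>1,(a+b)/2,(b-a)/2\<^esub>\<close>, whose minors with consecutive
  rows and columns are the \<open>T\<^bsub>\<alpha>,j,k\<^esub>\<close> up to sign, the value \<open>h \<alpha> n k\<close> is, also up to sign and the factor
  \<open>1 / T\<^bsub>1,e,m\<^sub>1\<^esub>\<close>, the minor with \<open>\<alpha> + 1\<close> consecutive rows centred at \<open>s \<alpha> n\<close>, \<open>\<alpha>\<close> consecutive columns
  centred at \<open>s \<alpha> n + 2k + 1\<close>, and the extra column \<open>e + m\<^sub>1\<close>.  Hence \<open>h\<close> vanishes when the extra column is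
  repeated (\<open>h_vanish\<close>) and for \<open>\<alpha> = r + 1\<close> (\<open>h_top\<close>).
\<close>

primrec h :: "nat \<Rightarrow> int \<Rightarrow> int \<Rightarrow> 'a" where
  "h 0 n k = T 1 (e - n) (m 1 + n) / T 1 e (m 1)"
| "h (Suc \<alpha>) n k =
     (T (Suc \<alpha>) (s (Suc \<alpha>) n + k + 1) k * h \<alpha> n (k + 1)
      - T (Suc \<alpha>) (s (Suc \<alpha>) n + k) (k + 1) * h \<alpha> (n - 1) k) / T \<alpha> (s (Suc \<alpha>) n + k + 1) (k + 1)"

declare h.simps(2) [simp del]

lemma h_A: "h (Suc \<alpha>) n k * T \<alpha> (s \<alpha> n + k + 2) (k + 1)
    = T (Suc \<alpha>) (s \<alpha> n + k + 2) k * h \<alpha> n (k + 1) - T (Suc \<alpha>) (s \<alpha> n + k + 1) (k + 1) * h \<alpha> (n - 1) k"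
proof -
  have "s (Suc \<alpha>) n + k + 1 = s \<alpha> n + k + 2" "s (Suc \<alpha>) n + k = s \<alpha> n + k + 1"
    by (simp_all add: s_def)
  then show ?thesis
    by (simp only: h.simps) simp
qed

text \<open>Cramer's rule: \<open>B\<close> and \<open>h_A\<close> at \<open>k - 1\<close> are two
  linear equations for \<open>h \<alpha> n k\<close> and \<open>h \<alpha> (n - 1) (k - 1)\<close>
  whose determinant factors by the T-system, and the factor with index \<open>\<alpha>\<close>
  cancels. \<open>B\<close> is a hypothesis because \<open>h_B\<close> is proved by induction
  through this lemma.\<close>

lemma h_C_of_B:
  assumes \<alpha>: "\<alpha> < r"
    and B: "h (Suc \<alpha>) n k * T \<alpha> (s \<alpha> n + k + 1) k
      = T (Suc \<alpha>) (s \<alpha> n + k + 2) k * h \<alpha> n k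
        - T (Suc \<alpha>) (s \<alpha> n + k + 1) (k + 1) * h \<alpha> (n - 1) (k - 1)"
  shows "T (Suc (Suc \<alpha>)) (s \<alpha> n + k + 1) k * h \<alpha> (n - 1) (k - 1)
        = h (Suc \<alpha>) n (k - 1) * T (Suc \<alpha>) (s \<alpha> n + k + 2) k
          - h (Suc \<alpha>) n k * T (Suc \<alpha>) (s \<alpha> n + k + 1) (k - 1)" (is ?C1)
    and "T (Suc (Suc \<alpha>)) (s \<alpha> n + k + 1) k * h \<alpha> n k
        = h (Suc \<alpha>) n (k - 1) * T (Suc \<alpha>) (s \<alpha> n + k + 1) (k + 1)
          - h (Suc \<alpha>) n k * T (Suc \<alpha>) (s \<alpha> n + k) k" (is ?C2)
proof -
  have A: "h (Suc \<alpha>) n (k - 1) * T \<alpha> (s \<alpha> n + k + 1) k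
      = T (Suc \<alpha>) (s \<alpha> n + k + 1) (k - 1) * h \<alpha> n k - T (Suc \<alpha>) (s \<alpha> n + k) k * h \<alpha> (n - 1) (k - 1)"
    using h_A[of \<alpha> n "k - 1"] by (simp add: algebra_simps)
  have sys: "T (Suc \<alpha>) (s \<alpha> n + k + 1) (k + 1) * T (Suc \<alpha>) (s \<alpha> n + k + 1) (k - 1)
      = T (Suc \<alpha>) (s \<alpha> n + k + 2) k * T (Suc \<alpha>) (s \<alpha> n + k) k
        + T (Suc (Suc \<alpha>)) (s \<alpha> n + k + 1) k * T \<alpha> (s \<alpha> n + k + 1) k"
    using T_rec[of "Suc \<alpha>" "s \<alpha> n + k + 1" k] \<alpha> by (simp add: add.assoc)
  show ?C1 ?C2
    by (rule three_term[OF B A sys nz])+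
qed

text \<open>For index 0 it coincides with \<open>h_A\<close>, as \<open>h 0\<close> is constant in
  \<open>k\<close>. In the induction step the two relations of \<open>h_C_of_B\<close>, at
  \<open>(n, k + 1)\<close> and \<open>(n - 1, k)\<close>, express the same
  \<open>h \<alpha> (n - 1) k\<close>; eliminating it turns \<open>h_A\<close> into the
  claim.\<close>

lemma h_B: "\<alpha> \<le> r \<Longrightarrow> h (Suc \<alpha>) n k * T \<alpha> (s \<alpha> n + k + 1) k
    = T (Suc \<alpha>) (s \<alpha> n + k + 2) k * h \<alpha> n k - T (Suc \<alpha>) (s \<alpha> n + k + 1) (k + 1) * h \<alpha> (n - 1) (k - 1)"
proof (induction \<alpha> arbitrary: n k)
  case 0
  show ?case using h_A[of 0 n k] by simp
next
  case (Suc \<alpha>)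
  define s0 where "s0 = s \<alpha> n"
  have sS: "s (Suc \<alpha>) n = s0 + 1" "s \<alpha> (n - 1) = s0 + 2" "s \<alpha> n = s0"
    by (simp_all add: s_def s0_def)
  define v1 v2 where "v1 = T (Suc \<alpha>) (s0 + k + 2) k" and "v2 = T (Suc \<alpha>) (s0 + k + 3) (k + 1)"
  define p q where "p = T (Suc (Suc \<alpha>)) (s0 + k + 3) k" and "q = T (Suc (Suc \<alpha>)) (s0 + k + 2) (k + 1)"
  define g x1 x2 y1 y2 where "g = h \<alpha> (n - 1) k" and "x1 = h (Suc \<alpha>) n k"
    and "x2 = h (Suc \<alpha>) n (k + 1)" and "y1 = h (Suc \<alpha>) (n - 1) (k - 1)" and "y2 = h (Suc \<alpha>) (n - 1) k"
  note abs = v1_def v2_def p_def q_def g_def x1_def x2_def y1_def y2_def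
  have "q * g = x1 * v2 - x2 * v1"
    using h_C_of_B(1)[of \<alpha> n "k + 1", OF _ Suc.IH] Suc.prems
    unfolding abs sS by (simp add: add.assoc add.commute[of k])
  moreover have "p * g = y1 * v2 - y2 * v1"
    using h_C_of_B(2)[of \<alpha> "n - 1" k, OF _ Suc.IH] Suc.prems
    unfolding abs sS by (simp add: add.assoc add.commute[of k] add.left_commute)
  ultimately have pq: "p * (x1 * v2 - x2 * v1) = q * (y1 * v2 - y2 * v1)"
    by (metis mult.left_commute)
  have A: "h (Suc (Suc \<alpha>)) n k * v2 = p * x2 - q * y2"
    using h_A[of "Suc \<alpha>" n k] unfolding abs sS by (simp add: add.assoc add.commute[of k] add.left_commute)
  have "(h (Suc (Suc \<alpha>)) n k * v1) * v2 = (h (Suc (Suc \<alpha>)) n k * v2) * v1"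
    by simp
  also have "\<dots> = (p * x1 - q * y1) * v2"
    unfolding A using pq by (simp add: algebra_simps)
  finally have "h (Suc (Suc \<alpha>)) n k * v1 = p * x1 - q * y1"
    by (simp add: v2_def)
  then show ?case
    unfolding abs sS by (simp add: add.assoc add.commute[of k] add.left_commute)
qed

lemmas h_C = h_C_of_B[OF _ h_B[OF less_imp_le]]

text \<open>\<open>h_A\<close> lowers \<open>n + m 1 - k\<close> by one and \<open>h_B\<close> keeps
  it, so \<open>h_B\<close> serves the left end of the window and \<open>h_A\<close> the rest. For
  index 1 the two terms of the definition are equal.\<close>

lemma h_vanish: "\<alpha> \<le> Suc r \<Longrightarrow> 1 \<le> n + m 1 - k \<Longrightarrow> n + m 1 - k \<le> int \<alpha> \<Longrightarrow> h \<alpha> n k = 0"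
proof (induction \<alpha> arbitrary: n k)
  case (Suc \<alpha>)
  show ?case
  proof (cases "\<alpha> = 0")
    case True
    with Suc.prems have k: "k = n + m 1 - 1" by simp
    show ?thesis
      unfolding True k by (simp add: h.simps s_def algebra_simps)
  next
    case False
    show ?thesis
    proof (cases "n + m 1 - k = 1")
      case True
      then have "h \<alpha> n k = 0" "h \<alpha> (n - 1) (k - 1) = 0"
        using Suc.IH[of n k] Suc.IH[of "n - 1" "k - 1"] Suc.prems False by auto
      then show ?thesis
        using h_B[of \<alpha> n k] Suc.prems by simp
    next
      case False
      then have "h \<alpha> n (k + 1) = 0" "h \<alpha> (n - 1) k = 0"
        using Suc.IH[of n "k + 1"] Suc.IH[of "n - 1" k] Suc.prems by auto
      then show ?thesis
        by (simp add: h.simps)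
    qed
  qed
qed simp

text \<open>With \<open>T (Suc r) = 1\<close>, \<open>h_A\<close> and \<open>h_B\<close> have the
  same right-hand side at neighbouring \<open>k\<close>; thus the value is constant in
  \<open>k\<close> and can be read off inside the window of \<open>h_vanish\<close>.\<close>

lemma h_top: "h (Suc r) n k = 0"
proof -
  have step: "h (Suc r) n k = h (Suc r) n (k - 1)" for k
  proof -
    have "h (Suc r) n (k - 1) * T r (s r n + k + 1) k = h r n k - h r (n - 1) (k - 1)"
      using h_A[of r n "k - 1"] by (simp add: algebra_simps)
    moreover have "h (Suc r) n k * T r (s r n + k + 1) k = h r n k - h r (n - 1) (k - 1)"
      using h_B[of r n k] by simp
    ultimately have "h (Suc r) n k * T r (s r n + k + 1) k = h (Suc r) n (k - 1) * T r (s r n + k + 1) k"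
      by (simp only:)
    then show ?thesis by simp
  qed
  have "h (Suc r) n k = h (Suc r) n (n + m 1 - 1)"
  proof (induction k rule: int_induct[where k = "n + m 1 - 1"])
    case (step1 i)
    then show ?case using step[of "i + 1"] by (simp only: add_diff_cancel_right')
  next
    case (step2 i)
    then show ?case using step[of i] by (simp only:)
  qed simp
  also have "\<dots> = 0"
    by (rule h_vanish) auto
  finally show ?thesis .
qed

section \<open>Edge weights and vertex values in closed form\<close>

definition lamT :: "nat \<Rightarrow> int \<Rightarrow> int \<Rightarrow> 'a" where
  "lamT \<alpha> t k = T \<alpha> t (k + 1) / T \<alpha> (t + 1) k"

definition muT :: "nat \<Rightarrow> int \<Rightarrow> int \<Rightarrow> 'a" where
  "muT \<alpha> t k = T \<alpha> t k / T (\<alpha> - 1) (t + 1) k"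

text \<open>
  \<open>X \<alpha> n\<close> and \<open>Y \<alpha> n\<close> are the weights of a step towards the root along the edges \<open>2\<alpha> + 1\<close> and \<open>2\<alpha>\<close>.
  Here and below, \<open>n\<close> is the number of steps towards the root (long ones included) that remain
  to be taken: a vertex of height \<open>x\<close> is then occupied at time \<open>e + x - 2n\<close>,
  so steps away from the root do not change \<open>n\<close>, and all others lower it by one.
\<close>

definition X :: "nat \<Rightarrow> int \<Rightarrow> 'a" where
  "X \<alpha> n = lamT (Suc \<alpha>) (s \<alpha> n + 1 + m (Suc \<alpha>)) (m (Suc \<alpha>)) / lamT \<alpha> (s \<alpha> n + 2 + m \<alpha>) (m \<alpha>)"

definition Y :: "nat \<Rightarrow> int \<Rightarrow> 'a" where
  "Y \<alpha> n = muT (Suc \<alpha>) (s \<alpha> n + 1 + m \<alpha>) (m \<alpha> + 1) / muT \<alpha> (s \<alpha> n + 1 + m \<alpha>) (m \<alpha>)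
     * (if m \<alpha> = m (Suc \<alpha>) + 1
        then lamT (Suc \<alpha>) (s \<alpha> n + 1 + m (Suc \<alpha>)) (m (Suc \<alpha>)) / lamT (Suc \<alpha>) (s \<alpha> n + 1 + m \<alpha>) (m \<alpha>)
        else 1)
     * (if m \<alpha> = m (\<alpha> - 1) - 1
        then lamT (\<alpha> - 1) (s \<alpha> n + 1 + m \<alpha>) (m \<alpha>) / lamT (\<alpha> - 1) (s \<alpha> n + 1 + m (\<alpha> - 1)) (m (\<alpha> - 1))
        else 1)"

text \<open>
  Up to truncation in \<open>n\<close>, \<open>z \<alpha> n\<close> is the sum over the paths from the top of edge \<open>2\<alpha>\<close> to the root,
  \<open>D \<alpha> n\<close> the part of it that starts with a step towards the root, and \<open>Y \<alpha> n * eps (\<alpha> - 1) (n - 1)\<close> the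
  same part computed from the values at the vertices below.  That these agree (\<open>D_eq_Y_eps\<close>) is the
  heart of the proof.
\<close>

definition z :: "nat \<Rightarrow> int \<Rightarrow> 'a" where
  "z \<alpha> n = h \<alpha> n (m \<alpha>) / T \<alpha> (s \<alpha> n + m \<alpha> + 1) (m \<alpha>)"

definition D :: "nat \<Rightarrow> int \<Rightarrow> 'a" where
  "D \<alpha> n = z \<alpha> n - X \<alpha> n * z \<alpha> (n - 1) - z (Suc \<alpha>) n"

definition eps :: "nat \<Rightarrow> int \<Rightarrow> 'a" where
  "eps \<alpha> n =
     (if m (Suc \<alpha>) = m \<alpha> + 1 then X \<alpha> n * z \<alpha> (n - 1) + z (Suc \<alpha>) n
      else if m (Suc \<alpha>) = m \<alpha> then z \<alpha> n
      else z \<alpha> n + D \<alpha> (n + 1) / X \<alpha> (n + 1))"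

lemma X_nonzero [simp]: "X \<alpha> n \<noteq> 0"
  by (simp add: X_def lamT_def)

lemma s_simps: "s (Suc \<alpha>) n = s \<alpha> n + 1" "s \<alpha> (n - 1) = s \<alpha> n + 2" "s \<alpha> (n + 1) = s \<alpha> n - 2" "s \<alpha> (1 + n) = s \<alpha> n - 2"
  by (simp_all add: s_def)

lemma z_top: "z (Suc r) n = 0"
  by (simp add: z_def h_top)

lemma m_cases:
  assumes "\<alpha> \<le> r"
  obtains "m (Suc \<alpha>) = m \<alpha> + 1" | "m (Suc \<alpha>) = m \<alpha>" | "m (Suc \<alpha>) = m \<alpha> - 1"
  using m_step[OF assms] by linarith

text \<open>The right-hand side is \<open>z \<alpha> n\<close> with \<open>m \<alpha> + 1\<close> in
  place of \<open>m \<alpha>\<close>. Over a common denominator the sum becomes one term, by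
  \<open>h_A\<close> on a flat step and by \<open>h_B\<close> on an ascent.\<close>

lemma up_closed:
  assumes "\<alpha> \<le> r" "m \<alpha> \<le> m (Suc \<alpha>)"
  shows "X \<alpha> n * z \<alpha> (n - 1) + z (Suc \<alpha>) n
    = h \<alpha> n (m \<alpha> + 1) / T \<alpha> (s \<alpha> n + m \<alpha> + 2) (m \<alpha> + 1)"
proof (rule m_cases[OF assms(1)])
  assume m': "m (Suc \<alpha>) = m \<alpha>"
  have "X \<alpha> n * z \<alpha> (n - 1) + z (Suc \<alpha>) n =
    (h (Suc \<alpha>) n (m \<alpha>) * T \<alpha> (s \<alpha> n + m \<alpha> + 2) (m \<alpha> + 1)
     + T (Suc \<alpha>) (s \<alpha> n + m \<alpha> + 1) (m \<alpha> + 1) * h \<alpha> (n - 1) (m \<alpha>))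
      / (T (Suc \<alpha>) (s \<alpha> n + m \<alpha> + 2) (m \<alpha>) * T \<alpha> (s \<alpha> n + m \<alpha> + 2) (m \<alpha> + 1))"
    by (simp add: X_def z_def lamT_def m' s_simps add_ac) (simp add: divide_simps)
  then show ?thesis
    unfolding h_A by simp
next
  assume m': "m (Suc \<alpha>) = m \<alpha> + 1"
  have "X \<alpha> n * z \<alpha> (n - 1) + z (Suc \<alpha>) n =
    (h (Suc \<alpha>) n (m \<alpha> + 1) * T \<alpha> (s \<alpha> n + (m \<alpha> + 1) + 1) (m \<alpha> + 1)
     + T (Suc \<alpha>) (s \<alpha> n + (m \<alpha> + 1) + 1) (m \<alpha> + 1 + 1) * h \<alpha> (n - 1) (m \<alpha> + 1 - 1))
      / (T (Suc \<alpha>) (s \<alpha> n + (m \<alpha> + 1) + 2) (m \<alpha> + 1) * T \<alpha> (s \<alpha> n + m \<alpha> + 2) (m \<alpha> + 1))"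
    by (simp add: X_def z_def lamT_def m' s_simps add_ac) (simp add: divide_simps)
  then show ?thesis
    unfolding h_B[OF assms(1)] by simp
qed (use assms in simp)

lemma eps_closed:
  assumes "\<alpha> \<le> r" "m \<alpha> \<le> m (Suc \<alpha>)"
  shows "eps \<alpha> n = h \<alpha> n (m (Suc \<alpha>)) / T \<alpha> (s \<alpha> n + m (Suc \<alpha>) + 1) (m (Suc \<alpha>))"
  using up_closed[OF assms, of n] by (cases rule: m_cases[OF assms(1)]) (use assms in \<open>auto simp: eps_def z_def add_ac\<close>)

text \<open>The quotient of \<open>D\<close> by \<open>X\<close> in \<open>eps\<close> stands for
  the long steps. Expanding \<open>D\<close> cancels \<open>z \<alpha> n\<close> and leaves a
  difference of neighbouring \<open>z\<close> at \<open>n + 1\<close>, which \<open>h_A\<close>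
  evaluates. Unlike in \<open>eps_closed\<close> a ratio of \<open>T\<close> remains; a factor of
  \<open>Y\<close> will absorb it.\<close>

lemma eps_closed_desc:
  assumes "m (Suc \<alpha>) = m \<alpha> - 1"
  shows "eps \<alpha> n = h \<alpha> n (m \<alpha> - 1) * T \<alpha> (s \<alpha> n + m \<alpha>) (m \<alpha> + 1)
    / (T \<alpha> (s \<alpha> n + m \<alpha> - 1) (m \<alpha>) * T \<alpha> (s \<alpha> n + m \<alpha> + 1) (m \<alpha>))"
proof -
  have hA: "h (Suc \<alpha>) (n + 1) (m \<alpha> - 1) * T \<alpha> (s \<alpha> n + m \<alpha> - 1) (m \<alpha>)
      = T (Suc \<alpha>) (s \<alpha> n + m \<alpha> - 1) (m \<alpha> - 1) * h \<alpha> (n + 1) (m \<alpha>)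
        - T (Suc \<alpha>) (s \<alpha> n + m \<alpha> - 2) (m \<alpha>) * h \<alpha> n (m \<alpha> - 1)"
    using h_A[of \<alpha> "n + 1" "m \<alpha> - 1"] by (simp add: s_simps algebra_simps)
  have "eps \<alpha> n = (z \<alpha> (n + 1) - z (Suc \<alpha>) (n + 1)) / X \<alpha> (n + 1)"
    using assms by (simp add: eps_def D_def field_simps)
  also have "z \<alpha> (n + 1) - z (Suc \<alpha>) (n + 1)
    = (T (Suc \<alpha>) (s \<alpha> n + m \<alpha> - 1) (m \<alpha> - 1) * h \<alpha> (n + 1) (m \<alpha>)
        - h (Suc \<alpha>) (n + 1) (m \<alpha> - 1) * T \<alpha> (s \<alpha> n + m \<alpha> - 1) (m \<alpha>))
      / (T (Suc \<alpha>) (s \<alpha> n + m \<alpha> - 1) (m \<alpha> - 1) * T \<alpha> (s \<alpha> n + m \<alpha> - 1) (m \<alpha>))"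
    by (simp add: z_def assms s_simps algebra_simps) (simp add: divide_simps)
  also have "\<dots> = T (Suc \<alpha>) (s \<alpha> n + m \<alpha> - 2) (m \<alpha>) * h \<alpha> n (m \<alpha> - 1)
      / (T (Suc \<alpha>) (s \<alpha> n + m \<alpha> - 1) (m \<alpha> - 1) * T \<alpha> (s \<alpha> n + m \<alpha> - 1) (m \<alpha>))"
    unfolding hA by simp
  also have "\<dots> / X \<alpha> (n + 1) = h \<alpha> n (m \<alpha> - 1) * T \<alpha> (s \<alpha> n + m \<alpha>) (m \<alpha> + 1)
    / (T \<alpha> (s \<alpha> n + m \<alpha> - 1) (m \<alpha>) * T \<alpha> (s \<alpha> n + m \<alpha> + 1) (m \<alpha>))"
    by (simp add: X_def lamT_def assms s_simps algebra_simps)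
  finally show ?thesis .
qed

text \<open>By \<open>up_closed\<close> the subtracted terms are \<open>z\<close> with
  \<open>m\<close> raised by one, so \<open>D\<close> is a difference of \<open>h\<close> at
  neighbouring \<open>k\<close>, which \<open>h_C\<close> evaluates.\<close>

lemma D_closed:
  assumes "Suc \<alpha> \<le> r" "m (Suc \<alpha>) \<le> m (Suc (Suc \<alpha>))"
  shows "D (Suc \<alpha>) n = h \<alpha> (n - 1) (m (Suc \<alpha>)) * T (Suc (Suc \<alpha>)) (s \<alpha> n + m (Suc \<alpha>) + 2) (m (Suc \<alpha>) + 1)
    / (T (Suc \<alpha>) (s \<alpha> n + m (Suc \<alpha>) + 2) (m (Suc \<alpha>)) * T (Suc \<alpha>) (s \<alpha> n + m (Suc \<alpha>) + 3) (m (Suc \<alpha>) + 1))"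
proof -
  let ?m = "m (Suc \<alpha>)"
  have C: "h (Suc \<alpha>) n ?m * T (Suc \<alpha>) (s \<alpha> n + ?m + 3) (?m + 1) - h (Suc \<alpha>) n (?m + 1) * T (Suc \<alpha>) (s \<alpha> n + ?m + 2) ?m
    = T (Suc (Suc \<alpha>)) (s \<alpha> n + ?m + 2) (?m + 1) * h \<alpha> (n - 1) ?m"
    using h_C(1)[of \<alpha> n "?m + 1"] assms(1) by (simp add: algebra_simps)
  have "D (Suc \<alpha>) n = z (Suc \<alpha>) n - h (Suc \<alpha>) n (?m + 1) / T (Suc \<alpha>) (s \<alpha> n + ?m + 3) (?m + 1)"
    using up_closed[OF assms, of n] unfolding D_def by (simp add: s_simps algebra_simps)
  also have "\<dots> = (h (Suc \<alpha>) n ?m * T (Suc \<alpha>) (s \<alpha> n + ?m + 3) (?m + 1) - h (Suc \<alpha>) n (?m + 1) * T (Suc \<alpha>) (s \<alpha> n + ?m + 2) ?m)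
    / (T (Suc \<alpha>) (s \<alpha> n + ?m + 2) ?m * T (Suc \<alpha>) (s \<alpha> n + ?m + 3) (?m + 1))"
    by (simp add: z_def s_simps algebra_simps) (simp add: divide_simps)
  finally show ?thesis
    unfolding C by (simp add: mult.commute)
qed

lemma D_closed_desc:
  assumes "Suc \<alpha> \<le> r" "m (Suc (Suc \<alpha>)) = m (Suc \<alpha>) - 1"
  shows "D (Suc \<alpha>) n = h \<alpha> (n - 1) (m (Suc \<alpha>))
    * T (Suc (Suc \<alpha>)) (s \<alpha> n + m (Suc \<alpha>) + 1) (m (Suc \<alpha>)) * T (Suc (Suc \<alpha>)) (s \<alpha> n + m (Suc \<alpha>) + 3) (m (Suc \<alpha>))
    / (T (Suc (Suc \<alpha>)) (s \<alpha> n + m (Suc \<alpha>) + 2) (m (Suc \<alpha>) - 1)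
       * T (Suc \<alpha>) (s \<alpha> n + m (Suc \<alpha>) + 2) (m (Suc \<alpha>)) * T (Suc \<alpha>) (s \<alpha> n + m (Suc \<alpha>) + 3) (m (Suc \<alpha>) + 1))"
proof -
  let ?m = "m (Suc \<alpha>)"
  have C: "h (Suc \<alpha>) (n - 1) (?m - 1) * T (Suc \<alpha>) (s \<alpha> n + ?m + 3) (?m + 1) - h (Suc \<alpha>) (n - 1) ?m * T (Suc \<alpha>) (s \<alpha> n + ?m + 2) ?m
    = T (Suc (Suc \<alpha>)) (s \<alpha> n + ?m + 3) ?m * h \<alpha> (n - 1) ?m"
    using h_C(2)[of \<alpha> "n - 1" ?m] assms(1) by (simp add: s_simps algebra_simps)
  have "D (Suc \<alpha>) n = X (Suc \<alpha>) n * (eps (Suc \<alpha>) (n - 1) - z (Suc \<alpha>) (n - 1))"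
    by (simp add: eps_def assms)
  also have "eps (Suc \<alpha>) (n - 1) - z (Suc \<alpha>) (n - 1)
    = (h (Suc \<alpha>) (n - 1) (?m - 1) * T (Suc \<alpha>) (s \<alpha> n + ?m + 3) (?m + 1) - h (Suc \<alpha>) (n - 1) ?m * T (Suc \<alpha>) (s \<alpha> n + ?m + 2) ?m)
      / (T (Suc \<alpha>) (s \<alpha> n + ?m + 2) ?m * T (Suc \<alpha>) (s \<alpha> n + ?m + 4) ?m)"
    unfolding eps_closed_desc[OF assms(2)] by (simp add: z_def s_simps algebra_simps) (simp add: divide_simps)
  also have "X (Suc \<alpha>) n * \<dots> = h \<alpha> (n - 1) (m (Suc \<alpha>))
    * T (Suc (Suc \<alpha>)) (s \<alpha> n + m (Suc \<alpha>) + 1) (m (Suc \<alpha>)) * T (Suc (Suc \<alpha>)) (s \<alpha> n + m (Suc \<alpha>) + 3) (m (Suc \<alpha>))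
    / (T (Suc (Suc \<alpha>)) (s \<alpha> n + m (Suc \<alpha>) + 2) (m (Suc \<alpha>) - 1)
       * T (Suc \<alpha>) (s \<alpha> n + m (Suc \<alpha>) + 2) (m (Suc \<alpha>)) * T (Suc \<alpha>) (s \<alpha> n + m (Suc \<alpha>) + 3) (m (Suc \<alpha>) + 1))"
    unfolding C by (simp add: X_def lamT_def assms s_simps algebra_simps)
  finally show ?thesis .
qed

text \<open>The slopes below and above \<open>Suc \<alpha>\<close> decouple. The factor
  \<open>B\<close> of \<open>Y\<close> brings \<open>eps\<close> to a form independent of the slope
  below, and the other conditional factor accounts for the two shapes of \<open>D\<close>, which
  depend on the slope above only.\<close>

lemma D_eq_Y_eps:
  assumes "Suc \<alpha> \<le> r"
  shows "D (Suc \<alpha>) n = Y (Suc \<alpha>) n * eps \<alpha> (n - 1)"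
proof -
  let ?m = "m (Suc \<alpha>)"
  define B where "B = (if ?m = m \<alpha> - 1
        then lamT \<alpha> (s \<alpha> n + 2 + ?m) ?m / lamT \<alpha> (s \<alpha> n + 2 + m \<alpha>) (m \<alpha>) else 1)"
  have Be: "B * eps \<alpha> (n - 1) = h \<alpha> (n - 1) ?m / T \<alpha> (s \<alpha> n + ?m + 3) ?m"
  proof (cases "?m = m \<alpha> - 1")
    case True
    then have m\<alpha>: "m \<alpha> = ?m + 1"
      by simp
    show ?thesis
      unfolding eps_closed_desc[OF True] B_def by (simp add: m\<alpha> lamT_def s_simps algebra_simps)
  next
    case False
    then have "m \<alpha> \<le> ?m"
      using m_step[of \<alpha>] assms by linarith
    then show ?thesis
      using eps_closed[of \<alpha> "n - 1"] False assms by (simp add: B_def s_simps algebra_simps)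
  qed
  have s2: "s (Suc \<alpha>) n + 1 + x = s \<alpha> n + 2 + x" for x
    by (simp add: s_simps)
  have "Y (Suc \<alpha>) n * eps \<alpha> (n - 1)
    = muT (Suc (Suc \<alpha>)) (s \<alpha> n + 2 + ?m) (?m + 1) / muT (Suc \<alpha>) (s \<alpha> n + 2 + ?m) ?m
     * (if ?m = m (Suc (Suc \<alpha>)) + 1
        then lamT (Suc (Suc \<alpha>)) (s \<alpha> n + 2 + m (Suc (Suc \<alpha>))) (m (Suc (Suc \<alpha>))) / lamT (Suc (Suc \<alpha>)) (s \<alpha> n + 2 + ?m) ?m
        else 1) * (B * eps \<alpha> (n - 1))"
    unfolding Y_def B_def s2 diff_Suc_1 by (simp only: mult.assoc)
  also have "\<dots> = D (Suc \<alpha>) n"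
  proof (cases "m (Suc (Suc \<alpha>)) = ?m - 1")
    case True
    show ?thesis
      unfolding Be D_closed_desc[OF assms True] True by (simp add: lamT_def muT_def algebra_simps)
  next
    case False
    then have "?m \<le> m (Suc (Suc \<alpha>))"
      using m_step[of "Suc \<alpha>"] assms by linarith
    then show ?thesis
      unfolding Be using D_closed[OF assms, of n] by (simp add: lamT_def muT_def algebra_simps)
  qed
  finally show ?thesis ..
qed

text \<open>
  The formula for \<open>z \<alpha> n\<close> gives spurious values when \<open>n\<close> is smaller than the number of steps
  needed to reach the root.  Since it vanishes for \<open>m \<alpha> - m 1 < n \<le> p \<alpha>\<close>, cutting it off at \<open>p \<alpha>\<close>
  keeps all vertex equations, except for a source term at the root.
\<close>

definition p :: "nat \<Rightarrow> int" where
  "p \<alpha> = int \<alpha> + m \<alpha> - m 1"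

definition zt :: "nat \<Rightarrow> int \<Rightarrow> 'a" where
  "zt \<alpha> n = (if p \<alpha> < n then z \<alpha> n else 0)"

definition Dt :: "nat \<Rightarrow> int \<Rightarrow> 'a" where
  "Dt \<alpha> n = (if p \<alpha> < n then D \<alpha> n else 0)"

definition et :: "nat \<Rightarrow> int \<Rightarrow> 'a" where
  "et \<alpha> n = (if p (Suc \<alpha>) \<le> n then eps \<alpha> n else 0)"

lemma z_vanish: "\<alpha> \<le> Suc r \<Longrightarrow> 1 \<le> n + m 1 - m \<alpha> \<Longrightarrow> n + m 1 - m \<alpha> \<le> int \<alpha> \<Longrightarrow> z \<alpha> n = 0"
  by (simp add: z_def h_vanish)

lemma zt_top: "zt (Suc r) n = 0"
  by (simp add: zt_def z_top)

text \<open>The cutoff \<open>p\<close> grows by 2, 1, 0 across an ascent, a flat step, a descent: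
  the number of extra steps towards the root. Here neighbouring cutoffs differ by at most one, and
  where they disagree \<open>z\<close> vanishes.\<close>

lemma zt_not_asc:
  assumes "1 \<le> \<alpha>" "\<alpha> \<le> r" "m (Suc \<alpha>) \<le> m \<alpha>"
  shows "zt \<alpha> n = zt (Suc \<alpha>) n + X \<alpha> n * zt \<alpha> (n - 1) + Dt \<alpha> n"
proof -
  have p': "p (Suc \<alpha>) = p \<alpha> + 1 \<or> p (Suc \<alpha>) = p \<alpha>"
    using m_step[of \<alpha>] assms by (auto simp: p_def)
  have "z (Suc \<alpha>) (p (Suc \<alpha>)) = 0" "z \<alpha> (p \<alpha>) = 0"
    using assms by (auto simp: p_def intro!: z_vanish)
  then have *: "zt (Suc \<alpha>) n = z (Suc \<alpha>) n" "zt \<alpha> (n - 1) = z \<alpha> (n - 1)" if "p \<alpha> < n"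
    using that p' unfolding zt_def by (metis add1_zle_eq le_less zle_diff1_eq zless_add1_eq less_le_trans)+
  show ?thesis
  proof (cases "p \<alpha> < n")
    case True
    then show ?thesis
      unfolding *[OF True] by (simp add: zt_def Dt_def D_def)
  next
    case False
    then show ?thesis
      using p' by (auto simp: zt_def Dt_def)
  qed
qed

lemma et_asc:
  assumes "\<alpha> \<le> r" "m (Suc \<alpha>) = m \<alpha> + 1"
  shows "et \<alpha> n = zt (Suc \<alpha>) n + X \<alpha> n * zt \<alpha> (n - 1)"
proof -
  have "p (Suc \<alpha>) = p \<alpha> + 2" "z (Suc \<alpha>) (p (Suc \<alpha>)) = 0"
    using assms by (auto simp: p_def intro!: z_vanish)
  then show ?thesis
    using assms by (cases "n = p (Suc \<alpha>)") (auto simp: et_def eps_def zt_def)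
qed

lemma zt_asc:
  assumes "1 \<le> \<alpha>" "\<alpha> \<le> r" "m (Suc \<alpha>) = m \<alpha> + 1"
  shows "zt \<alpha> n = et \<alpha> n + Dt \<alpha> n"
proof -
  have p': "p (Suc \<alpha>) = p \<alpha> + 2"
    using assms by (auto simp: p_def)
  \<comment> \<open>This needs \<open>1 \<le> \<alpha>\<close>: for \<open>\<alpha> = 0\<close> the
    argument \<open>p \<alpha> + 1 = 0\<close> leaves the window of \<open>z_vanish\<close>.\<close>
  have z0: "z (Suc \<alpha>) (p \<alpha> + 1) = 0" "z \<alpha> (p \<alpha>) = 0"
    using assms by (auto simp: p_def intro!: z_vanish)
  then have "eps \<alpha> (p \<alpha> + 1) = 0"
    by (simp add: eps_def assms)
  then show ?thesis
    using assms p' z0 by (cases "n = p \<alpha> + 1") (auto simp: et_def eps_def zt_def D_def Dt_def)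
qed

text \<open>\<open>eps 0\<close> and \<open>z 0\<close> agree, but their cutoffs differ exactly at
  \<open>n = 0\<close>, where \<open>z 0 0 = 1\<close>. This lost value is the contribution of the
  empty path.\<close>

lemma zt_root: "zt 0 n = et 0 n + (if n = 0 then 1 else 0)"
proof -
  have p': "p 0 = - 1" "p (Suc 0) = 1"
    by (simp_all add: p_def m_bottom)
  have "eps 0 n = z 0 n"
    using up_closed[of 0 n] by (simp add: eps_def m_bottom z_def)
  moreover have "z 0 0 = 1"
    by (simp add: z_def)
  ultimately show ?thesis
    by (auto simp: zt_def et_def p')
qed

lemma Dt_eq_Y_et: "Suc \<alpha> \<le> r \<Longrightarrow> Dt (Suc \<alpha>) n = Y (Suc \<alpha>) n * et \<alpha> (n - 1)"
  by (simp add: Dt_def et_def D_eq_Y_eps)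

lemma et_flat: "m (Suc \<alpha>) = m \<alpha> \<Longrightarrow> et \<alpha> n = zt \<alpha> n"
  by (simp add: et_def zt_def p_def eps_def)

lemma et_desc:
  assumes "1 \<le> \<alpha>" "\<alpha> \<le> r" "m (Suc \<alpha>) = m \<alpha> - 1"
  shows "et \<alpha> n = zt \<alpha> n + Dt \<alpha> (n + 1) / X \<alpha> (n + 1)"
proof -
  have "p (Suc \<alpha>) = p \<alpha>" "z \<alpha> (p \<alpha>) = 0"
    using assms by (auto simp: p_def intro!: z_vanish)
  then show ?thesis
    using assms by (cases "n = p \<alpha>") (auto simp: et_def eps_def zt_def Dt_def)
qed

lemma p_Suc_ge: "\<alpha> \<le> r \<Longrightarrow> 1 \<le> p (Suc \<alpha>)"
proof (induction \<alpha>)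
  case (Suc \<alpha>)
  then show ?case
    using m_step[of "Suc \<alpha>"] by (simp add: p_def)
qed (simp add: p_def)

lemma zt_neg: "\<alpha> \<le> r \<Longrightarrow> n < 0 \<Longrightarrow> zt \<alpha> n = 0"
  using p_Suc_ge[of "\<alpha> - 1"] by (cases \<alpha>) (auto simp: zt_def p_def m_bottom)

lemma et_nonpos: "\<alpha> \<le> r \<Longrightarrow> n \<le> 0 \<Longrightarrow> et \<alpha> n = 0"
  using p_Suc_ge[of \<alpha>] by (simp add: et_def)

lemma zt_0: "0 \<le> n \<Longrightarrow> zt 0 n = T 1 (e - n) (m 1 + n) / T 1 e (m 1)"
  by (simp add: zt_def z_def p_def m_bottom)

end

section \<open>Weighted shifts and path sums\<close>

text \<open>Step operators, their products and the inverses inside long steps all have this form;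
  recording \<open>k\<close> and \<open>w\<close> turns operator products into scalar
  products.\<close>

definition shift_op :: "int \<Rightarrow> (int \<Rightarrow> ratfun) \<Rightarrow> oper \<Rightarrow> bool" where
  "shift_op k w A \<longleftrightarrow> (\<forall>x t. Poly_Mapping.lookup (A x) (t + k) = Poly_Mapping.lookup x t * w t)"

lemma shift_op_wshift: "shift_op 1 w (wshift w)"
  by (simp add: shift_op_def lookup_wshift)

lemma shift_op_inv_wshift:
  assumes "\<And>t. w t \<noteq> 0"
  shows "shift_op (- 1) (\<lambda>t. 1 / w (t - 1)) (inv (wshift w))"
  unfolding shift_op_def
proof (intro allI)
  fix x t
  have "wshift w (inv (wshift w) x) = x"
    by (rule surj_f_inv_f[OF bij_is_surj[OF bij_wshift[OF assms]]])
  then have "Poly_Mapping.lookup x t = Poly_Mapping.lookup (inv (wshift w) x) (t - 1) * w (t - 1)"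
    by (metis lookup_wshift)
  then show "Poly_Mapping.lookup (inv (wshift w) x) (t + - 1) = Poly_Mapping.lookup x t * (1 / w (t - 1))"
    using assms[of "t - 1"] by simp
qed

lemma shift_op_prod_Nil: "shift_op 0 (\<lambda>t. 1) (op_prod [])"
  by (simp add: shift_op_def op_prod_def)

lemma shift_op_prod_Cons:
  assumes "shift_op k w A" "shift_op l v (op_prod As)"
  shows "shift_op (k + l) (\<lambda>t. w t * v (t + k)) (op_prod (A # As))"
  unfolding shift_op_def
proof (intro allI)
  fix x t
  have "Poly_Mapping.lookup (op_prod (A # As) x) ((t + k) + l) = Poly_Mapping.lookup x t * w t * v (t + k)"
    using assms unfolding shift_op_def op_prod_def by simp
  then show "Poly_Mapping.lookup (op_prod (A # As) x) (t + (k + l)) = Poly_Mapping.lookup x t * (w t * v (t + k))"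
    by (simp add: add.assoc)
qed

definition skel_wt :: "nat \<Rightarrow> (nat \<Rightarrow> int) \<Rightarrow> vertex \<Rightarrow> vertex \<Rightarrow> int \<Rightarrow> ratfun" where
  "skel_wt r m u v t =
     (if up_step r m u v then 1
      else ywt r m (edge_label r m v u) (t - int (ascents m (edge_label r m v u div 2))))"

lemma skel_op_wshift: "skel_op r m u v = wshift (skel_wt r m u v)"
  by (simp add: skel_op_def skel_wt_def[abs_def] d_op_def Y_op_def)

lemma skel_wt_nonzero: "skel_wt r m u v t \<noteq> 0"
  by (simp add: skel_wt_def ywt_nonzero)

text \<open>The downward step ends at time \<open>t + 1\<close>; each inverse reads its weight one
  unit before the time at which it acts, hence at \<open>t\<close> and \<open>t - 1\<close>, and the
  remaining factors start at \<open>t - 1\<close>. The first clause is a default for an impossible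
  source.\<close>

fun long_wt :: "nat \<Rightarrow> (nat \<Rightarrow> int) \<Rightarrow> nat \<Rightarrow> nat \<Rightarrow> int \<Rightarrow> ratfun" where
  "long_wt r m 0 l t = 1"
| "long_wt r m (Suc i) l t =
     (if i = l then skel_wt r m (Spine (Suc i)) (Spine i) t
      else skel_wt r m (Spine (Suc i)) (Spine i) t * (1 / skel_wt r m (Side i) (Spine i) t)
        * (1 / skel_wt r m (Spine i) (Side i) (t - 1)) * long_wt r m i l (t - 1))"

lemma shift_op_cong: "shift_op k w A \<Longrightarrow> k = k' \<Longrightarrow> (\<And>t. w t = w' t) \<Longrightarrow> shift_op k' w' A"
  by (simp add: shift_op_def)

lemma shift_op_long_op: "l < i \<Longrightarrow> shift_op (2 - (int i - int l)) (long_wt r m i l) (long_op r m i l)"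
proof (induction i)
  case (Suc i)
  show ?case
  proof (cases "i = l")
    case True
    have "shift_op (1 + 0) (\<lambda>t. skel_wt r m (Spine (Suc i)) (Spine i) t * 1)
        (op_prod [skel_op r m (Spine (Suc i)) (Spine i)])"
      unfolding skel_op_wshift by (rule shift_op_prod_Cons[OF shift_op_wshift shift_op_prod_Nil])
    then show ?thesis
      by (auto simp: True long_op_def intro: shift_op_cong)
  next
    case False
    then have "rev [l + 1..<Suc i] = i # rev [l + 1..<i]"
      using Suc.prems by simp
    then have long: "long_op r m (Suc i) l =
      op_prod (skel_op r m (Spine (Suc i)) (Spine i) # inv (skel_op r m (Side i) (Spine i))
        # inv (skel_op r m (Spine i) (Side i)) # [long_op r m i l])"
      by (simp add: long_op_def op_prod_def)
    have "shift_op (2 - (int i - int l)) (long_wt r m i l) (op_prod [long_op r m i l])"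
      using Suc.IH False Suc.prems by (simp add: op_prod_def)
    then show ?thesis
      unfolding long skel_op_wshift
      by (rule shift_op_cong[OF shift_op_prod_Cons[OF shift_op_wshift
            shift_op_prod_Cons[OF shift_op_inv_wshift[OF skel_wt_nonzero]
            shift_op_prod_Cons[OF shift_op_inv_wshift[OF skel_wt_nonzero]]]]])
        (use False in auto)
  qed
qed simp

definition step_wt :: "nat \<Rightarrow> (nat \<Rightarrow> int) \<Rightarrow> vertex \<Rightarrow> vertex \<Rightarrow> int \<Rightarrow> ratfun" where
  "step_wt r m u v t =
     (if skel_step r m u v then skel_wt r m u v t
      else (case (u, v) of (Spine i, Spine l) \<Rightarrow> long_wt r m i l t | _ \<Rightarrow> 1))"

lemma shift_op_step_op:
  assumes "graph_step r m u v"
  shows "shift_op (step_time r m u v) (step_wt r m u v) (step_op r m u v)"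
proof (cases "skel_step r m u v")
  case True
  then show ?thesis
    by (simp add: step_time_def step_wt_def[abs_def] step_op_def skel_op_wshift shift_op_wshift)
next
  case False
  with assms obtain i l where il: "u = Spine i" "v = Spine l" "long_edge r m i l"
    by (auto simp: graph_step_def)
  then have "l < i"
    using long_edge_le by fastforce
  with False il shift_op_long_op show ?thesis
    by (auto simp: step_time_def step_wt_def[abs_def] step_op_def)
qed

fun path_wt :: "nat \<Rightarrow> (nat \<Rightarrow> int) \<Rightarrow> vertex list \<Rightarrow> int \<Rightarrow> ratfun" where
  "path_wt r m (u # v # p) t = step_wt r m u v t * path_wt r m (v # p) (t + step_time r m u v)"
| "path_wt r m p t = 1"

lemma shift_op_path:
  "successively (graph_step r m) p \<Longrightarrow>
    shift_op (path_time r m p) (path_wt r m p) (op_prod (map2 (step_op r m) p (tl p)))"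
proof (induction p rule: induct_list012)
  case (3 u v p)
  have "shift_op (step_time r m u v + path_time r m (v # p))
     (\<lambda>t. step_wt r m u v t * path_wt r m (v # p) (t + step_time r m u v))
     (op_prod (step_op r m u v # map2 (step_op r m) (v # p) (tl (v # p))))"
    using 3 by (intro shift_op_prod_Cons shift_op_step_op) auto
  then show ?case
    by (auto simp: path_time_def intro: shift_op_cong)
qed (use shift_op_prod_Nil in \<open>auto simp: path_time_def intro: shift_op_cong\<close>)

section \<open>Path sums from an arbitrary vertex and their first-step decomposition\<close>

definition paths :: "nat \<Rightarrow> (nat \<Rightarrow> int) \<Rightarrow> int \<Rightarrow> vertex \<Rightarrow> int \<Rightarrow> vertex list set" where
  "paths r m t' v t = {p. p \<noteq> [] \<and> hd p = v \<and> last p = Spine 0 \<and>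
     successively (graph_step r m) p \<and> path_time r m p = t' - t}"

definition path_sum :: "nat \<Rightarrow> (nat \<Rightarrow> int) \<Rightarrow> int \<Rightarrow> vertex \<Rightarrow> int \<Rightarrow> ratfun" where
  "path_sum r m t' v t = (\<Sum>p \<in> paths r m t' v t. path_wt r m p t)"

lemma path_weight_eq:
  assumes "successively (graph_step r m) p" "path_time r m p = t' - t"
  shows "path_weight r m t t' p = path_wt r m p t"
proof -
  have "Poly_Mapping.lookup (op_prod (map2 (step_op r m) p (tl p)) (basis_vec t)) (t + path_time r m p)
      = path_wt r m p t"
    using shift_op_path[OF assms(1)] by (simp add: shift_op_def basis_vec_def)
  then show ?thesis
    by (simp add: path_weight_def assms)
qed

lemma partition_function_eq: "partition_function r m t t' = path_sum r m t' (Spine 0) t"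
  unfolding partition_function_def path_sum_def
  by (rule sum.cong) (auto simp: root_paths_def paths_def path_weight_eq)

lemma path_vertices_insert:
  "successively (graph_step r m) p \<Longrightarrow> p \<noteq> [] \<Longrightarrow> set p \<subseteq> insert (hd p) (vertices r m)"
  by (induction p rule: induct_list012) (auto dest: graph_step_vertices)

lemma paths_length_le:
  assumes "p \<in> paths r m t' v t"
  shows "int (length p) - 1 \<le> (2 * int r + 2) * (t' - t + height v) - height v"
  using length_path_le[of r m p] assms by (simp add: paths_def)

lemma finite_paths: "finite (paths r m t' v t)"
proof (rule finite_subset)
  let ?n = "nat (1 + (2 * int r + 2) * (t' - t + height v) - height v)"
  show "paths r m t' v t \<subseteq> {p. set p \<subseteq> insert v (vertices r m) \<and> length p \<le> ?n}"
  proof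
    fix p
    assume p: "p \<in> paths r m t' v t"
    then have "set p \<subseteq> insert v (vertices r m)"
      using path_vertices_insert[of r m p] by (auto simp: paths_def)
    moreover have "length p \<le> ?n"
      using paths_length_le[OF p] by linarith
    ultimately show "p \<in> {p. set p \<subseteq> insert v (vertices r m) \<and> length p \<le> ?n}"
      by simp
  qed
  show "finite {p. set p \<subseteq> insert v (vertices r m) \<and> length p \<le> ?n}"
    by (rule finite_lists_length_le) (simp add: vertices_def)
qed

lemma path_sum_empty:
  assumes "(2 * int r + 2) * (t' - t + height v) < height v"
  shows "path_sum r m t' v t = 0"
proof -
  have "paths r m t' v t = {}"
  proof (rule equals0I)
    fix p
    assume p: "p \<in> paths r m t' v t"
    then have "1 \<le> int (length p)"
      by (cases p) (auto simp: paths_def)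
    with paths_length_le[OF p] assms show False
      by linarith
  qed
  then show ?thesis
    by (simp add: path_sum_def)
qed

lemma finite_succ: "finite {u. graph_step r m v u}"
proof (rule finite_subset)
  show "{u. graph_step r m v u} \<subseteq> vertices r m"
    using graph_step_vertices by blast
qed (simp add: vertices_def)

lemma paths_first_step:
  "paths r m t' v t = (if v = Spine 0 \<and> t = t' then {[v]} else {})
     \<union> (\<Union>u \<in> {u. graph_step r m v u}. Cons v ` paths r m t' u (t + step_time r m v u))" (is "_ = ?R")
proof (rule set_eqI)
  fix p :: "vertex list"
  consider "p = []" | x where "p = [x]" | x u q where "p = x # u # q"
    by (metis neq_Nil_conv)
  then show "p \<in> paths r m t' v t \<longleftrightarrow> p \<in> ?R"
  proof cases
    case 3
    have "p \<in> paths r m t' v t \<longleftrightarrow> x = v \<and> graph_step r m v u \<and> u # q \<in> paths r m t' u (t + step_time r m v u)"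
      using 3 by (auto simp: paths_def path_time_def)
    also have "\<dots> \<longleftrightarrow> p \<in> ?R"
      using 3 by (auto simp: paths_def image_iff)
    finally show ?thesis .
  qed (auto simp: paths_def path_time_def)
qed

lemma path_sum_rec:
  "path_sum r m t' v t = (if v = Spine 0 \<and> t = t' then 1 else 0)
     + (\<Sum>u \<in> {u. graph_step r m v u}. step_wt r m v u t * path_sum r m t' u (t + step_time r m v u))"
proof -
  let ?P = "\<lambda>u. Cons v ` paths r m t' u (t + step_time r m v u)"
  let ?S = "{u. graph_step r m v u}"
  have "path_sum r m t' v t = (\<Sum>p \<in> (if v = Spine 0 \<and> t = t' then {[v]} else {}). path_wt r m p t)
     + (\<Sum>p \<in> (\<Union>u \<in> ?S. ?P u). path_wt r m p t)"
    unfolding path_sum_def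
    by (subst paths_first_step, rule sum.union_disjoint)
      (auto simp: finite_paths finite_succ, auto simp: paths_def)
  also have "(\<Sum>p \<in> (\<Union>u \<in> ?S. ?P u). path_wt r m p t) = (\<Sum>u \<in> ?S. \<Sum>p \<in> ?P u. path_wt r m p t)"
    by (rule sum.UNION_disjoint) (auto simp: finite_paths finite_succ, auto simp: paths_def)
  also have "\<dots> = (\<Sum>u \<in> ?S. step_wt r m v u t * path_sum r m t' u (t + step_time r m v u))"
  proof (rule sum.cong[OF refl])
    fix u
    have "(\<Sum>p \<in> ?P u. path_wt r m p t) = (\<Sum>p \<in> paths r m t' u (t + step_time r m v u). path_wt r m (v # p) t)"
      by (subst sum.reindex) auto
    also have "\<dots> = (\<Sum>p \<in> paths r m t' u (t + step_time r m v u).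
        step_wt r m v u t * path_wt r m p (t + step_time r m v u))"
    proof (rule sum.cong[OF refl])
      fix p
      assume "p \<in> paths r m t' u (t + step_time r m v u)"
      then obtain q where "p = u # q"
        by (cases p) (auto simp: paths_def)
      then show "path_wt r m (v # p) t = step_wt r m v u t * path_wt r m p (t + step_time r m v u)"
        by simp
    qed
    finally show "(\<Sum>p \<in> ?P u. path_wt r m p t)
        = step_wt r m v u t * path_sum r m t' u (t + step_time r m v u)"
      by (simp add: path_sum_def sum_distrib_left)
  qed
  finally show ?thesis
    by auto
qed

section \<open>Edges of the graph\<close>

text \<open>
  \<open>Spine (bt m \<alpha>)\<close> is the top of edge \<open>2\<alpha>\<close>; the root takes this place for \<open>\<alpha> = 0\<close>.  The vertex
  \<open>branch r m \<alpha>\<close> is the upper end of edge \<open>2\<alpha> + 1\<close>, on the spine or on the side.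
\<close>

definition bt :: "(nat \<Rightarrow> int) \<Rightarrow> nat \<Rightarrow> nat" where
  "bt m \<alpha> = (if \<alpha> = 0 then 0 else Suc (bot m \<alpha>))"

text \<open>The indices whose edge 2\<alpha>+1 lies on the spine. The edges 1 and 2r+1 always do, in
  accordance with the conventions for \<open>m 0\<close> and \<open>m (r + 1)\<close>.\<close>

definition asc :: "nat \<Rightarrow> (nat \<Rightarrow> int) \<Rightarrow> nat \<Rightarrow> bool" where
  "asc r m \<alpha> \<longleftrightarrow> \<alpha> = 0 \<or> \<alpha> = r \<or> m (Suc \<alpha>) = m \<alpha> + 1"

definition branch :: "nat \<Rightarrow> (nat \<Rightarrow> int) \<Rightarrow> nat \<Rightarrow> vertex" where
  "branch r m \<alpha> = (if asc r m \<alpha> then Spine (Suc (bt m \<alpha>)) else Side (bt m \<alpha>))"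

lemma ascents_Suc:
  "ascents m (Suc \<alpha>) = ascents m \<alpha> + (if 1 \<le> \<alpha> \<and> m (Suc \<alpha>) = m \<alpha> + 1 then 1 else 0)"
proof (cases "1 \<le> \<alpha>")
  case True
  then have "{\<gamma> \<in> {1..<Suc \<alpha>}. m (\<gamma> + 1) = m \<gamma> + 1} =
      (if m (Suc \<alpha>) = m \<alpha> + 1 then insert \<alpha> else id) {\<gamma> \<in> {1..<\<alpha>}. m (\<gamma> + 1) = m \<gamma> + 1}"
    by (auto simp: less_Suc_eq)
  then show ?thesis
    using True by (simp add: ascents_def)
qed (simp add: ascents_def)

lemma bot_Suc: "\<alpha> < r \<Longrightarrow> bot m (Suc \<alpha>) = bt m \<alpha> + (if asc r m \<alpha> then 1 else 0)"
  by (auto simp: bt_def bot_def asc_def ascents_Suc) (simp_all add: ascents_def)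

lemma bot_mono: "\<alpha> \<le> \<beta> \<Longrightarrow> bot m \<alpha> \<le> bot m \<beta>"
  by (rule lift_Suc_mono_le[of "bot m"]) (simp_all add: bot_def ascents_Suc)

lemma bt_Suc: "\<alpha> < r \<Longrightarrow> bt m (Suc \<alpha>) = bt m \<alpha> + (if asc r m \<alpha> then 2 else 1)"
  using bot_Suc[of \<alpha> r m] by (simp add: bt_def)

text \<open>The summand for an ascent accounts for the spine vertex
  \<open>branch r m \<alpha>\<close>, which thus lies strictly below the next top; all coincidence
  questions between vertices reduce to this.\<close>

lemma bt_less: "\<alpha> < \<beta> \<Longrightarrow> \<beta> \<le> r \<Longrightarrow> bt m \<alpha> + (if asc r m \<alpha> then 1 else 0) < bt m \<beta>"
proof (induction \<beta>)
  case (Suc \<beta>)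
  show ?case
  proof (cases "\<alpha> = \<beta>")
    case True
    then show ?thesis
      using bt_Suc[of \<alpha> r m] Suc.prems by simp
  next
    case False
    then show ?thesis
      using bt_Suc[of \<beta> r m] Suc by simp
  qed
qed simp

lemma bt_eq_iff: "\<alpha> \<le> r \<Longrightarrow> \<beta> \<le> r \<Longrightarrow> bt m \<alpha> = bt m \<beta> \<longleftrightarrow> \<alpha> = \<beta>"
  using bt_less[of \<alpha> \<beta> r m] bt_less[of \<beta> \<alpha> r m] by (cases \<alpha> \<beta> rule: linorder_cases) auto

lemma bt_neq_Suc_bt: "\<alpha> \<le> r \<Longrightarrow> \<beta> \<le> r \<Longrightarrow> asc r m \<beta> \<Longrightarrow> bt m \<alpha> \<noteq> Suc (bt m \<beta>)"
  using bt_less[of \<alpha> \<beta> r m] bt_less[of \<beta> \<alpha> r m] by (cases \<alpha> \<beta> rule: linorder_cases) auto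

lemma bt_pos: "1 \<le> \<alpha> \<Longrightarrow> bt m \<alpha> = Suc (bot m \<alpha>)"
  by (simp add: bt_def)

lemma ends_even: "1 \<le> \<alpha> \<Longrightarrow> ends r m (2 * \<alpha>) = (Spine (bot m \<alpha>), Spine (bt m \<alpha>))"
  by (simp add: ends_def bt_def Let_def)

lemma ends_odd: "\<alpha> \<le> r \<Longrightarrow> ends r m (Suc (2 * \<alpha>)) = (Spine (bt m \<alpha>), branch r m \<alpha>)"
  by (auto simp: ends_def bt_def Let_def branch_def asc_def)

lemma label_cases:
  assumes "\<beta> \<in> {1..2 * r + 1}"
  obtains \<alpha> where "1 \<le> \<alpha>" "\<alpha> \<le> r" "\<beta> = 2 * \<alpha>" | \<alpha> where "\<alpha> \<le> r" "\<beta> = Suc (2 * \<alpha>)"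
  using assms by (cases "even \<beta>") (auto elim!: evenE oddE)

lemma ends_inj:
  assumes "\<beta> \<in> {1..2 * r + 1}" "\<beta>' \<in> {1..2 * r + 1}" "ends r m \<beta> = ends r m \<beta>'"
  shows "\<beta> = \<beta>'"
proof -
  have mixed: False if "1 \<le> \<alpha>" "\<alpha> \<le> r" "\<alpha>' \<le> r" "ends r m (2 * \<alpha>) = ends r m (Suc (2 * \<alpha>'))" for \<alpha> \<alpha>'
    using that bt_neq_Suc_bt[of \<alpha> r \<alpha>' m] by (auto simp: ends_even ends_odd branch_def split: if_splits)
  show ?thesis
    by (rule label_cases[OF assms(1)]; rule label_cases[OF assms(2)])
      (use assms(3) mixed mixed[OF _ _ _ sym] in \<open>auto simp: ends_even ends_odd bt_eq_iff\<close>)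
qed

lemma edge_label_ends:
  assumes "\<beta> \<in> {1..2 * r + 1}" "ends r m \<beta> = (u, v)"
  shows "edge_label r m u v = \<beta>"
  unfolding edge_label_def by (rule the_equality) (use assms ends_inj in \<open>metis (full_types)\<close>)+

lemma edge_label_even: "1 \<le> \<alpha> \<Longrightarrow> \<alpha> \<le> r \<Longrightarrow> edge_label r m (Spine (bot m \<alpha>)) (Spine (bt m \<alpha>)) = 2 * \<alpha>"
  by (rule edge_label_ends) (simp_all add: ends_even)

lemma edge_label_odd: "\<alpha> \<le> r \<Longrightarrow> edge_label r m (Spine (bt m \<alpha>)) (branch r m \<alpha>) = Suc (2 * \<alpha>)"
  by (rule edge_label_ends) (simp_all add: ends_odd)

lemma up_step_iff:
  "up_step r m u v \<longleftrightarrow> (\<exists>\<alpha>. 1 \<le> \<alpha> \<and> \<alpha> \<le> r \<and> u = Spine (bot m \<alpha>) \<and> v = Spine (bt m \<alpha>))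
    \<or> (\<exists>\<alpha>\<le>r. u = Spine (bt m \<alpha>) \<and> v = branch r m \<alpha>)" (is "_ \<longleftrightarrow> ?R")
proof
  assume "up_step r m u v"
  then obtain \<beta> where \<beta>: "\<beta> \<in> {1..2 * r + 1}" "ends r m \<beta> = (u, v)"
    by (auto simp: up_step_def)
  from \<beta>(1) show ?R
    by (rule label_cases) (use \<beta>(2) ends_even ends_odd in auto)
next
  assume ?R
  then obtain \<beta> where "\<beta> \<in> {1..2 * r + 1}" "ends r m \<beta> = (u, v)"
  proof (elim disjE exE conjE)
    fix \<alpha>
    assume "1 \<le> \<alpha>" "\<alpha> \<le> r" "u = Spine (bot m \<alpha>)" "v = Spine (bt m \<alpha>)"
    then show ?thesis
      by (intro that[of "2 * \<alpha>"]) (simp_all add: ends_even)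
  next
    fix \<alpha>
    assume "\<alpha> \<le> r" "u = Spine (bt m \<alpha>)" "v = branch r m \<alpha>"
    then show ?thesis
      by (intro that[of "Suc (2 * \<alpha>)"]) (simp_all add: ends_odd)
  qed
  then show "up_step r m u v"
    by (auto simp: up_step_def)
qed

lemma up_step_height: "up_step r m u v \<Longrightarrow> height v = height u + 1"
  by (auto simp: up_step_def dest: height_ends)

lemma not_up_step_down: "up_step r m u v \<Longrightarrow> \<not> up_step r m v u"
  using up_step_height[of r m u v] up_step_height[of r m v u] by auto

text \<open>
  \<open>lo m \<alpha>\<close> is the first index of the maximal descending run through \<open>\<alpha>\<close>.
\<close>

primrec lo :: "(nat \<Rightarrow> int) \<Rightarrow> nat \<Rightarrow> nat" where
  "lo m 0 = 0"
| "lo m (Suc \<alpha>) = (if 1 \<le> \<alpha> \<and> m (Suc \<alpha>) = m \<alpha> - 1 then lo m \<alpha> else Suc \<alpha>)"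

lemma lo_le: "lo m \<alpha> \<le> \<alpha>"
  by (induction \<alpha>) auto

lemma lo_pos: "1 \<le> \<alpha> \<Longrightarrow> 1 \<le> lo m \<alpha>"
  by (induction \<alpha>) auto

lemma lo_run: "lo m \<alpha> \<le> \<gamma> \<Longrightarrow> \<gamma> < \<alpha> \<Longrightarrow> m (Suc \<gamma>) = m \<gamma> - 1"
  by (induction \<alpha>) (auto simp: less_Suc_eq split: if_splits)

lemma lo_le_run: "a \<le> \<gamma> \<Longrightarrow> 1 \<le> a \<Longrightarrow> (\<And>\<delta>. a \<le> \<delta> \<Longrightarrow> \<delta> < \<gamma> \<Longrightarrow> m (Suc \<delta>) = m \<delta> - 1) \<Longrightarrow> lo m \<gamma> \<le> a"
proof (induction \<gamma>)
  case (Suc \<gamma>)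
  show ?case
  proof (cases "a = Suc \<gamma>")
    case False
    with Suc show ?thesis
      by auto
  qed (metis lo_le)
qed simp

lemma bot_run: "a \<le> \<gamma> \<Longrightarrow> 1 \<le> a \<Longrightarrow> (\<And>\<delta>. a \<le> \<delta> \<Longrightarrow> \<delta> < \<gamma> \<Longrightarrow> m (Suc \<delta>) = m \<delta> - 1)
    \<Longrightarrow> bot m \<gamma> = bot m a + (\<gamma> - a)"
proof (induction \<gamma>)
  case (Suc \<gamma>)
  show ?case
  proof (cases "a = Suc \<gamma>")
    case False
    with Suc show ?thesis
      by (auto simp: bot_def ascents_Suc)
  qed simp
qed simp

text \<open>A long edge is indexed by the \<open>\<alpha>\<close> whose edge 2\<alpha> has the
  source as its top; its targets reach down to the bottom of the run through
  \<open>\<alpha>\<close>. Conversely, extending that run upwards recovers the maximal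
  interval.\<close>

lemma long_edge_iff:
  "long_edge r m i l \<longleftrightarrow> (\<exists>\<alpha>. 1 \<le> \<alpha> \<and> \<alpha> \<le> r \<and> i = bt m \<alpha> \<and> bot m (lo m \<alpha>) \<le> l \<and> l < bot m \<alpha>)"
    (is "_ \<longleftrightarrow> ?R")
proof
  assume "long_edge r m i l"
  then obtain a c where ac: "descending r m a c" and il: "bot m a \<le> l" "l + 1 < i" "i \<le> bot m c + 1"
    by (auto simp: long_edge_def max_descending_def)
  from ac have run: "1 \<le> a" "a \<le> c" "c \<le> r" "\<And>\<delta>. a \<le> \<delta> \<Longrightarrow> \<delta> < c \<Longrightarrow> m (Suc \<delta>) = m \<delta> - 1"
    by (auto simp: descending_def)
  \<comment> \<open>Along a run \<open>bot\<close> increases by one at each index, so this is the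
    index with \<open>bt m \<gamma> = i\<close>.\<close>
  define \<gamma> where "\<gamma> = a + (i - 1 - bot m a)"
  have "bot m c = bot m a + (c - a)"
    using run by (intro bot_run) auto
  then have \<gamma>: "a \<le> \<gamma>" "\<gamma> \<le> c"
    using il run by (auto simp: \<gamma>_def)
  have "bot m \<gamma> = bot m a + (\<gamma> - a)"
    by (rule bot_run) (use run \<gamma> in auto)
  moreover have "lo m \<gamma> \<le> a"
    by (rule lo_le_run) (use run \<gamma> in auto)
  moreover from this have "bot m (lo m \<gamma>) \<le> bot m a"
    by (intro bot_mono)
  ultimately have "1 \<le> \<gamma> \<and> \<gamma> \<le> r \<and> i = bt m \<gamma> \<and> bot m (lo m \<gamma>) \<le> l \<and> l < bot m \<gamma>"
    using il run \<gamma> by (auto simp: \<gamma>_def bt_def)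
  then show ?R ..
next
  assume ?R
  then obtain \<alpha> where \<alpha>: "1 \<le> \<alpha>" "\<alpha> \<le> r" "i = bt m \<alpha>" "bot m (lo m \<alpha>) \<le> l" "l < bot m \<alpha>"
    by blast
  then have "lo m \<alpha> \<noteq> \<alpha>"
    by auto
  with lo_le[of m \<alpha>] have "lo m \<alpha> < \<alpha>"
    by simp
  then have d: "descending r m (lo m \<alpha>) \<alpha>"
    using \<alpha> lo_pos[of \<alpha> m] lo_run[of m \<alpha>] by (auto simp: descending_def)
  \<comment> \<open>The upper end of the maximal run; it exists because runs stop at
    \<open>r\<close>.\<close>
  define c where "c = (GREATEST c. descending r m (lo m \<alpha>) c)"
  have c: "descending r m (lo m \<alpha>) c" "\<alpha> \<le> c"
    unfolding c_def using d
    by (rule GreatestI_nat[where b = r] Greatest_le_nat[where b = r], simp add: descending_def)+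
  have c_max: "c' \<le> c" if "descending r m (lo m \<alpha>) c'" for c'
    unfolding c_def using that by (rule Greatest_le_nat[where b = r]) (auto simp: descending_def)
  have "max_descending r m (lo m \<alpha>) c"
    unfolding max_descending_def
  proof (intro conjI allI impI c(1), elim conjE)
    fix a' c'
    assume a': "descending r m a' c'" and sub: "{lo m \<alpha>..c} \<subseteq> {a'..c'}"
    have le: "a' \<le> lo m \<alpha>" "c \<le> c'"
      using sub c(1) by (auto simp: descending_def)
    have "lo m \<alpha> \<le> a'"
      using lo_le_run[of a' \<alpha> m] a' le \<open>lo m \<alpha> < \<alpha>\<close> c(2) by (auto simp: descending_def)
    then have "a' = lo m \<alpha>"
      using le by simp
    then show "{lo m \<alpha>..c} = {a'..c'}"
      using c_max[of c'] a' le by simp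
  qed
  then show "long_edge r m i l"
    unfolding long_edge_def using \<alpha> bot_mono[OF c(2), of m] by (intro exI[of _ "lo m \<alpha>"] exI[of _ c]) (auto simp: bt_def)
qed

section \<open>Laurent monomials\<close>

definition monomials :: "'a::field set \<Rightarrow> 'a set" where
  "monomials X = {\<Prod>x \<in> Poly_Mapping.keys e. x powi Poly_Mapping.lookup e x | e :: 'a \<Rightarrow>\<^sub>0 int.
     Poly_Mapping.keys e \<subseteq> X}"

lemma monomials_one: "1 \<in> monomials X"
  unfolding monomials_def by (rule CollectI, rule exI[of _ 0]) simp

lemma monomials_var: "x \<in> X \<Longrightarrow> x \<in> monomials X"
  unfolding monomials_def by (rule CollectI, rule exI[of _ "Poly_Mapping.single x 1"]) simp

lemma prod_keys_superset:
  fixes e :: "'a::field \<Rightarrow>\<^sub>0 int"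
  assumes "Poly_Mapping.keys e \<subseteq> S" "finite S"
  shows "(\<Prod>x \<in> Poly_Mapping.keys e. x powi Poly_Mapping.lookup e x) = (\<Prod>x \<in> S. x powi Poly_Mapping.lookup e x)"
  using assms by (intro prod.mono_neutral_left) (auto simp: in_keys_iff)

lemma monomials_divide:
  fixes X :: "'a::field set"
  assumes "0 \<notin> X" "f \<in> monomials X" "g \<in> monomials X"
  shows "f / g \<in> monomials X"
proof -
  from assms obtain d e :: "'a \<Rightarrow>\<^sub>0 int"
    where d: "Poly_Mapping.keys d \<subseteq> X" "f = (\<Prod>x \<in> Poly_Mapping.keys d. x powi Poly_Mapping.lookup d x)"
      and e: "Poly_Mapping.keys e \<subseteq> X" "g = (\<Prod>x \<in> Poly_Mapping.keys e. x powi Poly_Mapping.lookup e x)"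
    by (auto simp: monomials_def)
  let ?S = "Poly_Mapping.keys d \<union> Poly_Mapping.keys e"
  have sub: "Poly_Mapping.keys (d - e) \<subseteq> ?S"
    by (auto simp: in_keys_iff lookup_minus)
  have "f / g = (\<Prod>x \<in> ?S. x powi Poly_Mapping.lookup d x) / (\<Prod>x \<in> ?S. x powi Poly_Mapping.lookup e x)"
    unfolding d(2) e(2) by (simp add: prod_keys_superset[of _ ?S])
  also have "\<dots> = (\<Prod>x \<in> ?S. x powi Poly_Mapping.lookup (d - e) x)"
    unfolding prod_dividef[symmetric]
  proof (rule prod.cong[OF refl])
    fix x
    assume "x \<in> ?S"
    then have "x \<noteq> 0"
      using assms(1) d(1) e(1) by blast
    then show "x powi Poly_Mapping.lookup d x / x powi Poly_Mapping.lookup e x = x powi Poly_Mapping.lookup (d - e) x"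
      by (simp add: lookup_minus power_int_diff)
  qed
  also have "\<dots> = (\<Prod>x \<in> Poly_Mapping.keys (d - e). x powi Poly_Mapping.lookup (d - e) x)"
    using sub by (simp add: prod_keys_superset)
  finally show ?thesis
    using sub d(1) e(1) unfolding monomials_def by blast
qed

lemma monomials_mult:
  assumes "0 \<notin> X" "f \<in> monomials X" "g \<in> monomials X"
  shows "f * g \<in> monomials X"
  using monomials_divide[OF assms(1,2) monomials_divide[OF assms(1) monomials_one assms(3)]] by simp

lemma nonneg_laurent_zero: "nonneg_laurent X 0"
  unfolding nonneg_laurent_def by (rule exI[of _ 0]) simp

lemma nonneg_laurent_monomial: "f \<in> monomials X \<Longrightarrow> nonneg_laurent X f"
  unfolding monomials_def nonneg_laurent_def
proof (elim CollectE exE conjE)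
  fix e :: "'a \<Rightarrow>\<^sub>0 int"
  assume "Poly_Mapping.keys e \<subseteq> X" "f = (\<Prod>x \<in> Poly_Mapping.keys e. x powi Poly_Mapping.lookup e x)"
  then show "\<exists>P :: ('a \<Rightarrow>\<^sub>0 int) \<Rightarrow>\<^sub>0 int.
    (\<forall>e \<in> Poly_Mapping.keys P. Poly_Mapping.keys e \<subseteq> X \<and> 0 \<le> Poly_Mapping.lookup P e) \<and>
    f = (\<Sum>e \<in> Poly_Mapping.keys P. of_int (Poly_Mapping.lookup P e) * (\<Prod>x \<in> Poly_Mapping.keys e. x powi Poly_Mapping.lookup e x))"
    by (intro exI[of _ "Poly_Mapping.single e 1"]) simp
qed

lemma nonneg_laurent_add:
  fixes f g :: "'a::field"
  assumes "nonneg_laurent X f" "nonneg_laurent X g"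
  shows "nonneg_laurent X (f + g)"
proof -
  define mon where "mon e = (\<Prod>x \<in> Poly_Mapping.keys e. x powi Poly_Mapping.lookup e x)" for e :: "'a \<Rightarrow>\<^sub>0 int"
  obtain P Q :: "('a \<Rightarrow>\<^sub>0 int) \<Rightarrow>\<^sub>0 int"
    where P: "\<forall>e \<in> Poly_Mapping.keys P. Poly_Mapping.keys e \<subseteq> X \<and> 0 \<le> Poly_Mapping.lookup P e"
        "f = (\<Sum>e \<in> Poly_Mapping.keys P. of_int (Poly_Mapping.lookup P e) * mon e)"
      and Q: "\<forall>e \<in> Poly_Mapping.keys Q. Poly_Mapping.keys e \<subseteq> X \<and> 0 \<le> Poly_Mapping.lookup Q e"
        "g = (\<Sum>e \<in> Poly_Mapping.keys Q. of_int (Poly_Mapping.lookup Q e) * mon e)"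
    using assms unfolding nonneg_laurent_def mon_def by blast
  let ?S = "Poly_Mapping.keys P \<union> Poly_Mapping.keys Q"
  have ext: "(\<Sum>e \<in> Poly_Mapping.keys R. of_int (Poly_Mapping.lookup R e) * mon e)
      = (\<Sum>e \<in> ?S. of_int (Poly_Mapping.lookup R e) * mon e)" if "Poly_Mapping.keys R \<subseteq> ?S" for R
    using that by (intro sum.mono_neutral_left) (auto simp: in_keys_iff)
  have sub: "Poly_Mapping.keys (P + Q) \<subseteq> ?S"
    by (rule Poly_Mapping.keys_add)
  have "f + g = (\<Sum>e \<in> Poly_Mapping.keys (P + Q). of_int (Poly_Mapping.lookup (P + Q) e) * mon e)"
    unfolding P(2) Q(2) ext[OF Un_upper1] ext[OF Un_upper2] ext[OF sub]
    by (simp add: lookup_add distrib_right sum.distrib)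
  moreover have "Poly_Mapping.keys e \<subseteq> X \<and> 0 \<le> Poly_Mapping.lookup (P + Q) e"
    if "e \<in> Poly_Mapping.keys (P + Q)" for e
  proof -
    have "0 \<le> Poly_Mapping.lookup P e" "0 \<le> Poly_Mapping.lookup Q e"
      using P(1) Q(1) by (metis in_keys_iff order_refl)+
    then show ?thesis
      using that sub P(1) Q(1) by (auto simp: lookup_add)
  qed
  ultimately show ?thesis
    unfolding nonneg_laurent_def mon_def by blast
qed

lemma nonneg_laurent_sum:
  "finite A \<Longrightarrow> (\<And>a. a \<in> A \<Longrightarrow> nonneg_laurent X (f a)) \<Longrightarrow> nonneg_laurent X (\<Sum>a \<in> A. f a)"
  by (induction A rule: finite_induct) (auto intro: nonneg_laurent_zero nonneg_laurent_add)

section \<open>Path sums on the graph\<close>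

locale motzkin =
  fixes r :: nat and m :: "nat \<Rightarrow> int" and t1 :: int
  assumes r_pos: "1 \<le> r"
    and step: "\<And>\<alpha>. 1 \<le> \<alpha> \<Longrightarrow> \<alpha> < r \<Longrightarrow> \<bar>m (\<alpha> + 1) - m \<alpha>\<bar> \<le> 1"
begin

text \<open>The theorem leaves \<open>m\<close> arbitrary outside \<open>{1..r}\<close>; the two
  boundary values required by \<open>t_system\<close> are put in here.\<close>

definition M :: "nat \<Rightarrow> int" where
  "M = m(0 := m 1 - 1, Suc r := m r + 1)"

lemma M_eq: "1 \<le> \<alpha> \<Longrightarrow> \<alpha> \<le> r \<Longrightarrow> M \<alpha> = m \<alpha>"
  by (simp add: M_def)

lemma M_ends: "M 0 = m 1 - 1" "M (Suc r) = m r + 1" "M 1 = m 1" "M (Suc 0) = m 1"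
  using r_pos by (simp_all add: M_def)

sublocale t_system r "Tsol r" M t1
proof
  show "M (Suc r) = M r + 1" "M 0 = M 1 - 1"
    using r_pos by (simp_all add: M_def)
  show "\<bar>M (Suc \<alpha>) - M \<alpha>\<bar> \<le> 1" if "\<alpha> \<le> r" for \<alpha>
    using that step[of \<alpha>] r_pos by (cases "\<alpha> = 0"; cases "\<alpha> = r") (auto simp: M_def)
qed (use T_boundary T_system T_nonzero in auto)

lemma asc_iff: "\<alpha> \<le> r \<Longrightarrow> asc r m \<alpha> \<longleftrightarrow> M (Suc \<alpha>) = M \<alpha> + 1"
  using r_pos by (auto simp: asc_def M_def)

lemma lam_lamT: "\<alpha> \<le> Suc r \<Longrightarrow> lam r \<alpha> t n = lamT \<alpha> t n"
  by (auto simp: lam_def lamT_def)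

lemma mu_muT: "mu r \<alpha> t n = muT \<alpha> t n"
  by (simp add: mu_def muT_def)

text \<open>The boundary values of \<open>M\<close> make both ends ascents, so the conditional
  factors of \<open>Y\<close> are 1 where \<open>wA\<close> at \<open>r\<close> and
  \<open>wB\<close> at 1 are 1 by definition.\<close>

lemma ywt_even:
  assumes "1 \<le> \<alpha>" "\<alpha> \<le> r"
  shows "ywt r m (2 * \<alpha>) (s \<alpha> n + 1 + m 1) = Y \<alpha> n"
proof -
  have "wA r m \<alpha> (s \<alpha> n + 1 + m 1) =
    (if M \<alpha> = M (Suc \<alpha>) + 1
     then lamT (Suc \<alpha>) (s \<alpha> n + 1 + M (Suc \<alpha>)) (M (Suc \<alpha>)) / lamT (Suc \<alpha>) (s \<alpha> n + 1 + M \<alpha>) (M \<alpha>)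
     else 1)"
    using assms by (cases "\<alpha> = r") (auto simp: wA_def M_eq M_ends lam_lamT add_ac)
  moreover have "wB r m \<alpha> (s \<alpha> n + 1 + m 1) =
    (if M \<alpha> = M (\<alpha> - 1) - 1
     then lamT (\<alpha> - 1) (s \<alpha> n + 1 + M \<alpha>) (M \<alpha>) / lamT (\<alpha> - 1) (s \<alpha> n + 1 + M (\<alpha> - 1)) (M (\<alpha> - 1))
     else 1)"
    using assms by (cases "\<alpha> = 1") (auto simp: wB_def M_eq M_ends lam_lamT add_ac)
  ultimately show ?thesis
    using assms by (simp add: ywt_def Y_def mu_muT M_eq add_ac)
qed

text \<open>The offset differs at 0 since \<open>bt m 0\<close> is 0 and not
  \<open>Suc (bot m 0)\<close>; this matches the formula for edge 1, which lacks the shift by -1 of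
  the other odd edges.\<close>

lemma ywt_odd:
  assumes "\<alpha> \<le> r"
  shows "ywt r m (Suc (2 * \<alpha>)) (s \<alpha> n + (if \<alpha> = 0 then 1 else 2) + m 1) = X \<alpha> n"
proof (cases "\<alpha> = 0")
  case True
  then show ?thesis
    using r_pos by (simp add: ywt_def X_def M_ends lam_lamT) (simp add: lamT_def)
next
  case False
  then have lamS: "lam r (Suc \<alpha>) (s \<alpha> n + m (Suc \<alpha>) + 1) (m (Suc \<alpha>))
      = lamT (Suc \<alpha>) (s \<alpha> n + 1 + M (Suc \<alpha>)) (M (Suc \<alpha>))"
    using assms by (cases "\<alpha> = r") (auto simp: lam_lamT M_eq lamT_def add_ac)
  show ?thesis
    using False assms lamS by (simp add: ywt_def X_def M_eq lam_lamT add_ac)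
qed

lemma s_bt: "1 \<le> \<alpha> \<Longrightarrow> t1 + int (bt m \<alpha>) - 2 * n - int (ascents m \<alpha>) = s \<alpha> n + 1 + m 1"
  by (simp add: s_def bt_def bot_def M_ends)

lemma skel_wt_even:
  assumes "1 \<le> \<alpha>" "\<alpha> \<le> r"
  shows "skel_wt r m (Spine (bt m \<alpha>)) (Spine (bot m \<alpha>)) (t1 + int (bt m \<alpha>) - 2 * n) = Y \<alpha> n"
proof -
  have "\<not> up_step r m (Spine (bt m \<alpha>)) (Spine (bot m \<alpha>))"
    by (rule not_up_step_down) (use assms in \<open>auto simp: up_step_iff\<close>)
  then show ?thesis
    using assms s_bt[of \<alpha> n] ywt_even[of \<alpha> n] by (simp add: skel_wt_def edge_label_even)
qed

lemma skel_wt_odd: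
  assumes "\<alpha> \<le> r"
  shows "skel_wt r m (branch r m \<alpha>) (Spine (bt m \<alpha>)) (t1 + int (bt m \<alpha>) + 1 - 2 * n) = X \<alpha> n"
proof -
  have "\<not> up_step r m (branch r m \<alpha>) (Spine (bt m \<alpha>))"
    by (rule not_up_step_down) (use assms in \<open>auto simp: up_step_iff\<close>)
  moreover have "t1 + int (bt m \<alpha>) + 1 - 2 * n - int (ascents m \<alpha>) = s \<alpha> n + (if \<alpha> = 0 then 1 else 2) + m 1"
    using s_bt[of \<alpha> n] by (auto simp: s_def bt_def ascents_def M_ends)
  ultimately show ?thesis
    using assms ywt_odd[of \<alpha> n] by (simp add: skel_wt_def edge_label_odd)
qed

lemma skel_wt_up: "up_step r m u v \<Longrightarrow> skel_wt r m u v t = 1"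
  by (simp add: skel_wt_def)

section \<open>Vertex equations, indexed by the number of remaining steps towards the root\<close>

definition F :: "vertex \<Rightarrow> int \<Rightarrow> ratfun" where
  "F v n = path_sum r m t1 v (t1 + height v - 2 * n)"

lemma F_neg:
  assumes "n < 0"
  shows "F v n = 0"
proof -
  have "(2 * int r + 2) * (2 * n) < 0"
    using assms by (intro mult_pos_neg) auto
  moreover have "0 \<le> height v"
    by (cases v) auto
  moreover have "t1 - (t1 + height v - 2 * n) + height v = 2 * n"
    by simp
  ultimately show ?thesis
    unfolding F_def by (intro path_sum_empty) (simp only:)
qed

definition F_step :: "vertex \<Rightarrow> vertex \<Rightarrow> int \<Rightarrow> ratfun" where
  "F_step v u n = step_wt r m v u (t1 + height v - 2 * n)
     * path_sum r m t1 u (t1 + height v - 2 * n + step_time r m v u)"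

lemma F_rec:
  "F v n = (if v = Spine 0 \<and> n = 0 then 1 else 0) + (\<Sum>u \<in> {u. graph_step r m v u}. F_step v u n)"
  unfolding F_def F_step_def by (subst path_sum_rec) auto

lemma F_step_up: "up_step r m v u \<Longrightarrow> F_step v u n = F u n"
  by (simp add: F_step_def F_def step_wt_def step_time_def skel_step_def skel_wt_up up_step_height algebra_simps)

lemma F_step_down:
  "up_step r m u v \<Longrightarrow> F_step v u n = skel_wt r m v u (t1 + height v - 2 * n) * F u (n - 1)"
  by (simp add: F_step_def F_def step_wt_def step_time_def skel_step_def up_step_height algebra_simps)

lemma up_step_bot_bt: "1 \<le> \<alpha> \<Longrightarrow> \<alpha> \<le> r \<Longrightarrow> up_step r m (Spine (bot m \<alpha>)) (Spine (bt m \<alpha>))"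
  by (auto simp: up_step_iff)

lemma up_step_branch: "\<alpha> \<le> r \<Longrightarrow> up_step r m (Spine (bt m \<alpha>)) (branch r m \<alpha>)"
  by (auto simp: up_step_iff)

text \<open>A step from \<open>i\<close> to \<open>l\<close> changes the time by
  \<open>2 - (i - l)\<close> and the height by \<open>l - i\<close>, so it lowers \<open>n\<close>
  by exactly one. The skeleton step \<open>l = bot m \<alpha>\<close> is included, as
  \<open>long_wt\<close> then reduces to its weight.\<close>

lemma F_step_long:
  assumes "1 \<le> \<alpha>" "\<alpha> \<le> r" "bot m (lo m \<alpha>) \<le> l" "l \<le> bot m \<alpha>"
  shows "F_step (Spine (bt m \<alpha>)) (Spine l) n
    = long_wt r m (bt m \<alpha>) l (t1 + int (bt m \<alpha>) - 2 * n) * F (Spine l) (n - 1)"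
proof (cases "l = bot m \<alpha>")
  case True
  then show ?thesis
    using F_step_down[OF up_step_bot_bt[OF assms(1,2)]] assms(1) by (simp add: bt_def)
next
  case False
  then have "\<not> skel_step r m (Spine (bt m \<alpha>)) (Spine l)"
    using assms by (auto simp: skel_step_def bt_def dest: up_step_height)
  then show ?thesis
    by (simp add: F_step_def F_def step_wt_def step_time_def algebra_simps)
qed

definition descents :: "nat \<Rightarrow> int \<Rightarrow> ratfun" where
  "descents \<alpha> n = (\<Sum>l = bot m (lo m \<alpha>)..bot m \<alpha>.
     long_wt r m (bt m \<alpha>) l (t1 + int (bt m \<alpha>) - 2 * n) * F (Spine l) (n - 1))"

lemma bot_eq_bt_iff:
  assumes "1 \<le> \<gamma>" "\<gamma> \<le> r" "\<alpha> \<le> r"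
  shows "bot m \<gamma> = bt m \<alpha> \<longleftrightarrow> \<gamma> = Suc \<alpha> \<and> \<not> asc r m \<alpha>"
proof -
  obtain \<delta> where \<delta>: "\<gamma> = Suc \<delta>" "\<delta> < r"
    using assms by (cases \<gamma>) auto
  then show ?thesis
    using assms bt_neq_Suc_bt[of \<alpha> r \<delta> m] bt_eq_iff[of \<alpha> r \<delta> m] bot_Suc[OF \<delta>(2), of m] by auto
qed

lemma bot_eq_Suc_bt_iff:
  assumes "1 \<le> \<gamma>" "\<gamma> \<le> r" "\<alpha> \<le> r" "asc r m \<alpha>"
  shows "bot m \<gamma> = Suc (bt m \<alpha>) \<longleftrightarrow> \<gamma> = Suc \<alpha>"
proof -
  obtain \<delta> where \<delta>: "\<gamma> = Suc \<delta>" "\<delta> < r"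
    using assms by (cases \<gamma>) auto
  then show ?thesis
    using assms bt_neq_Suc_bt[of \<delta> r \<alpha> m] bt_eq_iff[of \<delta> r \<alpha> m] bot_Suc[OF \<delta>(2), of m] by auto
qed

lemma branch_neq_bt: "\<alpha> \<le> r \<Longrightarrow> \<gamma> \<le> r \<Longrightarrow> branch r m \<alpha> \<noteq> Spine (bt m \<gamma>)"
  using bt_neq_Suc_bt[of \<gamma> r \<alpha> m] by (auto simp: branch_def)

lemma branch_eq_iff: "\<alpha> \<le> r \<Longrightarrow> \<gamma> \<le> r \<Longrightarrow> branch r m \<alpha> = branch r m \<gamma> \<longleftrightarrow> \<alpha> = \<gamma>"
  by (auto simp: branch_def bt_eq_iff split: if_splits)

lemma asc_top: "asc r m r"
  by (simp add: asc_def)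

lemma succ_bt:
  assumes "\<alpha> \<le> r"
  shows "{u. graph_step r m (Spine (bt m \<alpha>)) u} =
     {branch r m \<alpha>} \<union> (if asc r m \<alpha> then {} else {Spine (bt m (Suc \<alpha>))})
     \<union> (if \<alpha> = 0 then {} else Spine ` {bot m (lo m \<alpha>)..bot m \<alpha>})" (is "?S = ?A")
proof (rule set_eqI)
  fix u
  have "graph_step r m (Spine (bt m \<alpha>)) u \<longleftrightarrow>
    up_step r m (Spine (bt m \<alpha>)) u \<or> up_step r m u (Spine (bt m \<alpha>)) \<or>
    (\<exists>l. u = Spine l \<and> 1 \<le> \<alpha> \<and> bot m (lo m \<alpha>) \<le> l \<and> l < bot m \<alpha>)"
    using assms unfolding graph_step_def skel_step_def long_edge_iff by (auto simp: bt_eq_iff)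
  also have "up_step r m (Spine (bt m \<alpha>)) u \<longleftrightarrow> u = branch r m \<alpha> \<or> (\<not> asc r m \<alpha> \<and> u = Spine (bt m (Suc \<alpha>)))"
  proof -
    have "(\<exists>\<gamma>. 1 \<le> \<gamma> \<and> \<gamma> \<le> r \<and> Spine (bt m \<alpha>) = Spine (bot m \<gamma>) \<and> u = Spine (bt m \<gamma>))
        \<longleftrightarrow> \<not> asc r m \<alpha> \<and> u = Spine (bt m (Suc \<alpha>))" (is "?E \<longleftrightarrow> ?N")
    proof
      assume ?E
      then show ?N
        using bot_eq_bt_iff[OF _ _ assms] by (metis vertex.inject(1))
    next
      assume ?N
      moreover from this have "Suc \<alpha> \<le> r"
        using assms asc_top by (cases "\<alpha> = r") auto
      ultimately show ?E
        using bot_eq_bt_iff[of "Suc \<alpha>" \<alpha>] assms by (intro exI[of _ "Suc \<alpha>"]) auto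
    qed
    then show ?thesis
      unfolding up_step_iff using assms by (auto simp: bt_eq_iff)
  qed
  also have "up_step r m u (Spine (bt m \<alpha>)) \<longleftrightarrow> 1 \<le> \<alpha> \<and> u = Spine (bot m \<alpha>)"
    unfolding up_step_iff using assms branch_neq_bt branch_neq_bt[symmetric] by (auto simp: bt_eq_iff)
  finally show "u \<in> ?S \<longleftrightarrow> u \<in> ?A"
    using bot_mono[OF lo_le[of m \<alpha>], of m] by (auto simp: le_less)
qed

lemma succ_branch:
  assumes "\<alpha> \<le> r"
  shows "{u. graph_step r m (branch r m \<alpha>) u} =
    (if asc r m \<alpha> \<and> \<alpha> < r then {Spine (bt m (Suc \<alpha>))} else {}) \<union> {Spine (bt m \<alpha>)}" (is "?S = ?A")
proof (rule set_eqI)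
  fix u
  have "graph_step r m (branch r m \<alpha>) u \<longleftrightarrow> up_step r m (branch r m \<alpha>) u \<or> up_step r m u (branch r m \<alpha>)"
    using assms branch_neq_bt[of \<alpha>] unfolding graph_step_def skel_step_def long_edge_iff by auto
  also have "up_step r m (branch r m \<alpha>) u \<longleftrightarrow> asc r m \<alpha> \<and> \<alpha> < r \<and> u = Spine (bt m (Suc \<alpha>))"
  proof -
    have "(\<exists>\<gamma>. 1 \<le> \<gamma> \<and> \<gamma> \<le> r \<and> branch r m \<alpha> = Spine (bot m \<gamma>) \<and> u = Spine (bt m \<gamma>))
        \<longleftrightarrow> asc r m \<alpha> \<and> \<alpha> < r \<and> u = Spine (bt m (Suc \<alpha>))" (is "?E \<longleftrightarrow> ?N")
    proof
      assume ?E
      then obtain \<gamma> where \<gamma>: "1 \<le> \<gamma>" "\<gamma> \<le> r" "branch r m \<alpha> = Spine (bot m \<gamma>)" "u = Spine (bt m \<gamma>)"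
        by blast
      then have "asc r m \<alpha>" "bot m \<gamma> = Suc (bt m \<alpha>)"
        by (auto simp: branch_def split: if_splits)
      then show ?N
        using \<gamma> bot_eq_Suc_bt_iff[of \<gamma> \<alpha>] assms by auto
    next
      assume ?N
      then show ?E
        using bot_eq_Suc_bt_iff[of "Suc \<alpha>" \<alpha>] assms by (intro exI[of _ "Suc \<alpha>"]) (auto simp: branch_def)
    qed
    then show ?thesis
      unfolding up_step_iff using assms branch_neq_bt[of \<alpha>] by auto
  qed
  also have "up_step r m u (branch r m \<alpha>) \<longleftrightarrow> u = Spine (bt m \<alpha>)"
    unfolding up_step_iff using assms branch_neq_bt[of \<alpha>] branch_eq_iff[of \<alpha>] by (metis (no_types, lifting))
  finally show "u \<in> ?S \<longleftrightarrow> u \<in> ?A"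
    by auto
qed

lemma height_branch: "height (branch r m \<alpha>) = int (bt m \<alpha>) + 1"
  by (simp add: branch_def)

lemma F_branch:
  assumes "\<alpha> \<le> r"
  shows "F (branch r m \<alpha>) n = (if asc r m \<alpha> \<and> \<alpha> < r then F (Spine (bt m (Suc \<alpha>))) n else 0)
    + X \<alpha> n * F (Spine (bt m \<alpha>)) (n - 1)"
proof -
  have down: "F_step (branch r m \<alpha>) (Spine (bt m \<alpha>)) n = X \<alpha> n * F (Spine (bt m \<alpha>)) (n - 1)"
    using assms skel_wt_odd[of \<alpha> n] by (simp add: F_step_down up_step_branch height_branch add.assoc)
  have up: "F_step (branch r m \<alpha>) (Spine (bt m (Suc \<alpha>))) n = F (Spine (bt m (Suc \<alpha>))) n"
    if "asc r m \<alpha>" "\<alpha> < r"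
    using that up_step_bot_bt[of "Suc \<alpha>"] bot_Suc[of \<alpha> r m] by (intro F_step_up) (simp add: branch_def)
  have neq: "\<alpha> < r \<Longrightarrow> bt m \<alpha> \<noteq> bt m (Suc \<alpha>)"
    using bt_Suc[of \<alpha> r m] by simp
  have "branch r m \<alpha> \<noteq> Spine 0"
    by (simp add: branch_def)
  then show ?thesis
    unfolding F_rec[of "branch r m \<alpha>"] succ_branch[OF assms] using down up neq by simp
qed

lemma F_bt:
  assumes "\<alpha> \<le> r"
  shows "F (Spine (bt m \<alpha>)) n = (if \<alpha> = 0 \<and> n = 0 then 1 else 0)
    + F (branch r m \<alpha>) n + (if asc r m \<alpha> then 0 else F (Spine (bt m (Suc \<alpha>))) n)
    + (if \<alpha> = 0 then 0 else descents \<alpha> n)"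
proof -
  let ?f = "\<lambda>u. F_step (Spine (bt m \<alpha>)) u n"
  let ?U = "if asc r m \<alpha> then {} else {Spine (bt m (Suc \<alpha>))}"
  let ?L = "if \<alpha> = 0 then {} else Spine ` {bot m (lo m \<alpha>)..bot m \<alpha>}"
  have \<alpha>_less: "\<not> asc r m \<alpha> \<Longrightarrow> \<alpha> < r"
    using assms asc_top by (cases "\<alpha> = r") auto
  have "(\<Sum>u \<in> {branch r m \<alpha>} \<union> ?U \<union> ?L. ?f u) = sum ?f ({branch r m \<alpha>} \<union> ?U) + sum ?f ?L"
  proof (rule sum.union_disjoint)
    have L: "height u \<le> int (bt m \<alpha>) - 1" if "u \<in> ?L" for u
      using that by (auto simp: bt_def split: if_splits)
    have U: "int (bt m \<alpha>) < height u" if "u \<in> {branch r m \<alpha>} \<union> ?U" for u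
      using that bt_Suc[of \<alpha> r m] \<alpha>_less by (auto simp: height_branch split: if_splits)
    show "({branch r m \<alpha>} \<union> ?U) \<inter> ?L = {}"
    proof (rule equals0I)
      fix u
      assume "u \<in> ({branch r m \<alpha>} \<union> ?U) \<inter> ?L"
      then show False
        using L[of u] U[of u] by simp
    qed
  qed auto
  also have "sum ?f ({branch r m \<alpha>} \<union> ?U) = sum ?f {branch r m \<alpha>} + sum ?f ?U"
    by (rule sum.union_disjoint) (auto simp: branch_def)
  also have "sum ?f {branch r m \<alpha>} = F (branch r m \<alpha>) n"
    by (simp add: F_step_up[OF up_step_branch[OF assms]])
  also have "sum ?f ?U = (if asc r m \<alpha> then 0 else F (Spine (bt m (Suc \<alpha>))) n)"
    using up_step_bot_bt[of "Suc \<alpha>"] bot_Suc[of \<alpha> r m] \<alpha>_less by (auto simp: F_step_up)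
  also have "sum ?f ?L = (if \<alpha> = 0 then 0 else descents \<alpha> n)"
    using assms by (auto simp: sum.reindex inj_on_def descents_def F_step_long intro!: sum.cong)
  finally show ?thesis
    unfolding F_rec[of "Spine (bt m \<alpha>)"] succ_bt[OF assms] by (simp add: bt_def)
qed

text \<open>
  The factorised weight of long steps turns the sum over all of them into a two-term recursion.
\<close>

lemma descents_rec:
  assumes "Suc \<alpha> \<le> r"
  shows "descents (Suc \<alpha>) n = Y (Suc \<alpha>) n * (F (Spine (bot m (Suc \<alpha>))) (n - 1)
    + (if 1 \<le> \<alpha> \<and> m (Suc \<alpha>) = m \<alpha> - 1 then descents \<alpha> n / X \<alpha> n else 0))"
proof -
  define t where "t = t1 + int (bt m (Suc \<alpha>)) - 2 * n"
  let ?b = "bot m (Suc \<alpha>)"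
  have Y: "skel_wt r m (Spine (Suc ?b)) (Spine ?b) t = Y (Suc \<alpha>) n"
    using skel_wt_even[of "Suc \<alpha>" n] assms by (simp add: t_def bt_def)
  have one: "long_wt r m (Suc ?b) ?b t = Y (Suc \<alpha>) n"
    using Y by simp
  show ?thesis
  proof (cases "1 \<le> \<alpha> \<and> m (Suc \<alpha>) = m \<alpha> - 1")
    case False
    then have "lo m (Suc \<alpha>) = Suc \<alpha>"
      by auto
    then show ?thesis
      unfolding if_not_P[OF False] using one by (simp add: descents_def t_def bt_pos del: long_wt.simps)
  next
    case True
    then have na: "\<not> asc r m \<alpha>"
      using assms by (auto simp: asc_def)
    then have b: "?b = bt m \<alpha>" "bt m \<alpha> = Suc (bot m \<alpha>)"
      using True assms bot_Suc[of \<alpha> r m] by (auto simp: bt_def)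
    have t: "t = t1 + int (bt m \<alpha>) + 1 - 2 * n" "t - 1 = t1 + int (bt m \<alpha>) - 2 * n"
      using b(1) by (simp_all add: t_def bt_def)
    have X: "skel_wt r m (Side ?b) (Spine ?b) t = X \<alpha> n"
      using skel_wt_odd[of \<alpha> n] na assms by (simp add: branch_def b(1) t(1))
    have "up_step r m (Spine ?b) (Side ?b)"
      using up_step_branch[of \<alpha>] na assms by (simp add: branch_def b(1))
    then have long: "long_wt r m (Suc ?b) l t = Y (Suc \<alpha>) n * (1 / X \<alpha> n) * long_wt r m ?b l (t - 1)"
      if "l \<le> bot m \<alpha>" for l
      using that Y X b by (simp add: skel_wt_up)
    \<comment> \<open>On a descent the run has the same lowest index, so the skeleton target is the
      only new one.\<close>
    have "{bot m (lo m (Suc \<alpha>))..?b} = insert ?b {bot m (lo m \<alpha>)..bot m \<alpha>}"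
      using True b bot_mono[OF lo_le[of m \<alpha>], of m] by auto
    then have "descents (Suc \<alpha>) n = long_wt r m (Suc ?b) ?b t * F (Spine ?b) (n - 1)
      + (\<Sum>l = bot m (lo m \<alpha>)..bot m \<alpha>. long_wt r m (Suc ?b) l t * F (Spine l) (n - 1))"
      unfolding descents_def using b by (simp add: t_def bt_pos)
    also have "(\<Sum>l = bot m (lo m \<alpha>)..bot m \<alpha>. long_wt r m (Suc ?b) l t * F (Spine l) (n - 1))
      = Y (Suc \<alpha>) n * (1 / X \<alpha> n) * descents \<alpha> n"
      unfolding descents_def sum_distrib_left
      by (rule sum.cong[OF refl]) (use long in \<open>simp add: b(1) t(2) mult.assoc\<close>)
    finally show ?thesis
      unfolding one using True by (simp add: algebra_simps)
  qed
qed

section \<open>Solution of the vertex equations\<close>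

definition solved :: "int \<Rightarrow> bool" where
  "solved n \<longleftrightarrow> (\<forall>\<alpha>\<le>r. F (Spine (bt m \<alpha>)) n = zt \<alpha> n \<and>
     F (branch r m \<alpha>) n = (if asc r m \<alpha> then et \<alpha> n else X \<alpha> n * zt \<alpha> (n - 1)))"

text \<open>The bracket in \<open>descents_rec\<close> is \<open>et \<alpha> (n - 1)\<close> for
  each slope; on a descent its second term is known from the induction over \<alpha> at the same
  \<open>n\<close>, which is where the third case of \<open>eps\<close> comes from.
  \<open>Dt_eq_Y_et\<close> then concludes.\<close>

lemma descents_solved:
  assumes "solved (n - 1)" "1 \<le> \<alpha>" "\<alpha> \<le> r"
  shows "descents \<alpha> n = Dt \<alpha> n"
  using assms(2,3)
proof (induction \<alpha>)
  case (Suc \<alpha>)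
  have F: "F (Spine (bot m (Suc \<alpha>))) (n - 1) = (if asc r m \<alpha> then et \<alpha> (n - 1) else zt \<alpha> (n - 1))"
  proof -
    have "F (Spine (bt m \<alpha>)) (n - 1) = zt \<alpha> (n - 1)" "asc r m \<alpha> \<Longrightarrow> F (branch r m \<alpha>) (n - 1) = et \<alpha> (n - 1)"
      using assms(1) Suc.prems by (simp_all add: solved_def)
    then show ?thesis
      using Suc.prems bot_Suc[of \<alpha> r m] by (simp add: branch_def)
  qed
  have M: "\<alpha> = 0 \<or> M \<alpha> = m \<alpha>" "M (Suc \<alpha>) = m (Suc \<alpha>)"
    by (cases "\<alpha> = 0") (use Suc.prems in \<open>auto simp: M_eq\<close>)
  have "F (Spine (bot m (Suc \<alpha>))) (n - 1)
      + (if 1 \<le> \<alpha> \<and> m (Suc \<alpha>) = m \<alpha> - 1 then descents \<alpha> n / X \<alpha> n else 0) = et \<alpha> (n - 1)"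
  proof (cases "asc r m \<alpha>")
    case True
    then show ?thesis
      using Suc.prems asc_iff[of \<alpha>] M unfolding F by auto
  next
    case False
    then have \<alpha>: "1 \<le> \<alpha>" "M (Suc \<alpha>) \<noteq> M \<alpha> + 1"
      using asc_iff[of \<alpha>] Suc.prems by (auto simp: asc_def)
    then consider "M (Suc \<alpha>) = M \<alpha>" | "M (Suc \<alpha>) = M \<alpha> - 1"
      using m_step[of \<alpha>] Suc.prems by fastforce
    then show ?thesis
      using False \<alpha> Suc.prems Suc.IH M et_flat[of \<alpha> "n - 1"] et_desc[of \<alpha> "n - 1"] unfolding F
      by cases auto
  qed
  then show ?case
    using Suc.prems by (simp add: descents_rec Dt_eq_Y_et)
qed simp

text \<open>Steps towards the root lead to \<open>n - 1\<close>, hence to known values. The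
  remaining unknowns at \<open>n\<close> belong to higher vertices and are eliminated from the top
  index \<open>r\<close> downwards, where \<open>zt_top\<close> replaces the missing upper
  neighbour.\<close>

lemma solved_step:
  assumes "solved (n - 1)"
  shows "solved n"
proof -
  have branch: "F (branch r m \<alpha>) n = (if asc r m \<alpha> then et \<alpha> n else X \<alpha> n * zt \<alpha> (n - 1))"
    if "\<alpha> \<le> r" "\<alpha> < r \<Longrightarrow> F (Spine (bt m (Suc \<alpha>))) n = zt (Suc \<alpha>) n" for \<alpha>
  proof -
    have "F (Spine (bt m \<alpha>)) (n - 1) = zt \<alpha> (n - 1)"
      using assms that by (simp add: solved_def)
    then show ?thesis
      using that et_asc[of \<alpha> n] zt_top[of n] unfolding F_branch[OF that(1)]
      by (cases "\<alpha> = r") (auto simp: asc_iff)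
  qed
  have bt: "F (Spine (bt m \<alpha>)) n = zt \<alpha> n"
    if "\<alpha> \<le> r" "\<alpha> < r \<Longrightarrow> F (Spine (bt m (Suc \<alpha>))) n = zt (Suc \<alpha>) n" for \<alpha>
  proof (cases "asc r m \<alpha>")
    case True
    have b: "F (branch r m \<alpha>) n = et \<alpha> n"
      using branch[of \<alpha>] that True by simp
    show ?thesis
      using True that(1) zt_root[of n] zt_asc[of \<alpha> n] descents_solved[OF assms, of \<alpha>]
      unfolding F_bt[OF that(1)] b by (cases "\<alpha> = 0") (auto simp: asc_iff)
  next
    case False
    then have "1 \<le> \<alpha>" "\<alpha> < r"
      using that(1) by (auto simp: asc_def)
    moreover have "M (Suc \<alpha>) \<le> M \<alpha>"
      using False that(1) m_step[of \<alpha>] by (auto simp: asc_iff)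
    moreover have "F (branch r m \<alpha>) n = X \<alpha> n * zt \<alpha> (n - 1)"
      using branch[of \<alpha>] that False by simp
    ultimately show ?thesis
      using False that zt_not_asc[of \<alpha> n] descents_solved[OF assms, of \<alpha>]
      unfolding F_bt[OF that(1)] by simp
  qed
  have all: "F (Spine (bt m \<alpha>)) n = zt \<alpha> n" if "\<alpha> \<le> r" for \<alpha>
    using that by (induction rule: inc_induct) (use bt in auto)
  then show ?thesis
    unfolding solved_def using branch by simp
qed

text \<open>Started at -1, where no path exists and the truncated values vanish; the empty path
  enters in the step to 0, through \<open>zt_root\<close>.\<close>

lemma solved: "- 1 \<le> n \<Longrightarrow> solved n"
proof (induction n rule: int_ge_induct)
  case base
  show ?case
    using zt_neg et_nonpos by (auto simp: solved_def F_neg)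
next
  case (step i)
  then show ?case
    using solved_step[of "i + 1"] by simp
qed

lemma path_sum_root:
  assumes "0 \<le> n"
  shows "path_sum r m t1 (Spine 0) (t1 - 2 * n) = Tsol r 1 (t1 - n) (m 1 + n) / Tsol r 1 t1 (m 1)"
proof -
  have "F (Spine 0) n = zt 0 n"
    using solved[of n] assms by (auto simp: solved_def bt_def dest: spec[of _ 0])
  then show ?thesis
    using assms by (simp add: F_def zt_0 M_ends)
qed

section \<open>Step weights as Laurent monomials in the cluster variables\<close>

lemma Tsol_monomial:
  assumes "1 \<le> \<alpha> \<Longrightarrow> \<alpha> \<le> r \<Longrightarrow> n = m \<alpha> \<or> n = m \<alpha> + 1" "\<alpha> \<le> Suc r"
  shows "Tsol r \<alpha> i n \<in> monomials (cluster_vars r m)"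
proof (cases "1 \<le> \<alpha> \<and> \<alpha> \<le> r")
  case True
  then show ?thesis
    using assms by (intro monomials_var) (auto simp: cluster_vars_def)
next
  case False
  then have "\<alpha> = 0 \<or> \<alpha> = Suc r"
    using assms(2) by auto
  then show ?thesis
    using monomials_one by auto
qed

lemma zero_notin_cluster_vars: "0 \<notin> cluster_vars r m"
  using T_nonzero by (auto simp: cluster_vars_def)

lemmas monomials_intros = monomials_one monomials_mult[OF zero_notin_cluster_vars]
  monomials_divide[OF zero_notin_cluster_vars]

lemma lam_monomial:
  assumes "\<alpha> \<le> Suc r" "1 \<le> \<alpha> \<Longrightarrow> \<alpha> \<le> r \<Longrightarrow> n = m \<alpha>"
  shows "lam r \<alpha> t n \<in> monomials (cluster_vars r m)"
  using assms unfolding lam_def by (auto intro!: monomials_intros Tsol_monomial)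

text \<open>On a descent above \<open>\<alpha>\<close> the first factor is not a cluster variable,
  since its level exceeds \<open>m (Suc \<alpha>) + 1\<close>; the denominator of \<open>wA\<close>
  cancels it and leaves one that is.\<close>

lemma wA_monomial:
  assumes "1 \<le> \<alpha>" "\<alpha> \<le> r"
  shows "Tsol r (Suc \<alpha>) (t + m \<alpha> - m 1) (m \<alpha> + 1) * wA r m \<alpha> t \<in> monomials (cluster_vars r m)"
proof (cases "\<alpha> < r \<and> m \<alpha> = m (\<alpha> + 1) + 1")
  case True
  then have "Tsol r (Suc \<alpha>) (t + m \<alpha> - m 1) (m \<alpha> + 1) * wA r m \<alpha> t
    = lam r (Suc \<alpha>) (t + m (Suc \<alpha>) - m 1) (m (Suc \<alpha>)) * Tsol r (Suc \<alpha>) (t + m \<alpha> - m 1 + 1) (m \<alpha>)"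
    unfolding wA_def by (simp add: lam_def[of r "Suc \<alpha>" _ "m (Suc \<alpha>) + 1"] T_nonzero)
  also have "\<dots> \<in> monomials (cluster_vars r m)"
    using True by (intro monomials_intros lam_monomial Tsol_monomial) auto
  finally show ?thesis .
next
  case False
  have "\<alpha> < r \<Longrightarrow> m \<alpha> + 1 = m (Suc \<alpha>) \<or> m \<alpha> + 1 = m (Suc \<alpha>) + 1"
    using False step[of \<alpha>] assms by auto
  then have "Tsol r (Suc \<alpha>) (t + m \<alpha> - m 1) (m \<alpha> + 1) \<in> monomials (cluster_vars r m)"
    using assms by (intro Tsol_monomial) auto
  then show ?thesis
    unfolding wA_def if_not_P[OF False] by simp
qed

text \<open>On a descent below \<open>\<alpha>\<close> the level \<open>m \<alpha>\<close> is too
  low for index \<open>\<alpha> - 1\<close>; the numerator of \<open>wB\<close> cancels this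
  variable against one at level \<open>m (\<alpha> - 1)\<close>.\<close>

lemma wB_monomial:
  assumes "1 \<le> \<alpha>" "\<alpha> \<le> r"
  shows "Tsol r (\<alpha> - 1) (t + m \<alpha> - m 1 + 1) (m \<alpha>) * wB r m \<alpha> t \<in> monomials (cluster_vars r m)"
proof (cases "1 < \<alpha> \<and> m \<alpha> = m (\<alpha> - 1) - 1")
  case True
  then have "Tsol r (\<alpha> - 1) (t + m \<alpha> - m 1 + 1) (m \<alpha>) * wB r m \<alpha> t
    = Tsol r (\<alpha> - 1) (t + m \<alpha> - m 1) (m (\<alpha> - 1)) / lam r (\<alpha> - 1) (t + m (\<alpha> - 1) - m 1) (m (\<alpha> - 1))"
    using assms unfolding wB_def by (simp add: lam_def[of r "\<alpha> - Suc 0" _ "m (\<alpha> - Suc 0) - 1"] T_nonzero)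
  also have "\<dots> \<in> monomials (cluster_vars r m)"
    using True assms by (intro monomials_intros lam_monomial Tsol_monomial) auto
  finally show ?thesis .
next
  case False
  have "1 < \<alpha> \<Longrightarrow> m \<alpha> = m (\<alpha> - 1) \<or> m \<alpha> = m (\<alpha> - 1) + 1"
  proof -
    assume "1 < \<alpha>"
    then have "1 \<le> \<alpha> - 1" "\<alpha> - 1 < r" "\<alpha> - 1 + 1 = \<alpha>"
      using assms by auto
    then have "\<bar>m \<alpha> - m (\<alpha> - 1)\<bar> \<le> 1"
      using step[of "\<alpha> - 1"] by simp
    then show ?thesis
      using False \<open>1 < \<alpha>\<close> by auto
  qed
  then have "Tsol r (\<alpha> - 1) (t + m \<alpha> - m 1 + 1) (m \<alpha>) \<in> monomials (cluster_vars r m)"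
    using assms by (intro Tsol_monomial) auto
  then show ?thesis
    unfolding wB_def if_not_P[OF False] by simp
qed

lemma ywt_monomial:
  assumes "\<beta> \<in> {1..2 * r + 1}"
  shows "ywt r m \<beta> t \<in> monomials (cluster_vars r m)"
  using assms
proof (cases rule: label_cases)
  case (1 \<alpha>)
  let ?s = "t + m \<alpha> - m 1"
  have "ywt r m \<beta> t = (Tsol r (Suc \<alpha>) ?s (m \<alpha> + 1) * wA r m \<alpha> t)
      * (Tsol r (\<alpha> - 1) (?s + 1) (m \<alpha>) * wB r m \<alpha> t) / Tsol r \<alpha> ?s (m \<alpha>) / Tsol r \<alpha> (?s + 1) (m \<alpha> + 1)"
    using 1 by (simp add: ywt_def mu_def mult_ac)
  then show ?thesis
    using 1 by (auto intro!: monomials_intros wA_monomial wB_monomial Tsol_monomial simp del: One_nat_def)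
next
  case (2 \<alpha>)
  show ?thesis
  proof (cases "\<alpha> = 0")
    case True
    then show ?thesis
      using 2 r_pos lam_monomial[of 1 "m 1"] by (simp add: ywt_def)
  next
    case False
    then have "ywt r m \<beta> t = lam r (Suc \<alpha>) (t + m (Suc \<alpha>) - m 1 - 1) (m (Suc \<alpha>)) / lam r \<alpha> (t + m \<alpha> - m 1) (m \<alpha>)"
      using 2 by (simp add: ywt_def)
    then show ?thesis
      using 2 by (auto intro!: monomials_intros lam_monomial)
  qed
qed

lemma skel_wt_monomial:
  assumes "skel_step r m u v"
  shows "skel_wt r m u v t \<in> monomials (cluster_vars r m)"
proof (cases "up_step r m u v")
  case True
  then show ?thesis
    by (simp add: skel_wt_up monomials_one)
next
  case False
  then obtain \<beta> where "\<beta> \<in> {1..2 * r + 1}" "ends r m \<beta> = (v, u)"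
    using assms by (auto simp: skel_step_def up_step_def)
  then show ?thesis
    using False ywt_monomial by (simp add: skel_wt_def edge_label_ends)
qed

text \<open>Induction down the descending run; the inverse side weights do no harm because monomials
  are closed under division.\<close>

lemma long_wt_monomial:
  "1 \<le> \<alpha> \<Longrightarrow> \<alpha> \<le> r \<Longrightarrow> bot m (lo m \<alpha>) \<le> l \<Longrightarrow> l \<le> bot m \<alpha> \<Longrightarrow>
    long_wt r m (bt m \<alpha>) l t \<in> monomials (cluster_vars r m)"
proof (induction \<alpha> arbitrary: t)
  case (Suc \<alpha>)
  let ?b = "bot m (Suc \<alpha>)"
  have skel: "skel_step r m (Spine (Suc ?b)) (Spine ?b)"
    using up_step_bot_bt[of "Suc \<alpha>"] Suc.prems by (simp add: skel_step_def bt_pos)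
  show ?case
  proof (cases "l = ?b")
    case True
    then show ?thesis
      using skel_wt_monomial[OF skel] by (simp add: bt_pos)
  next
    case False
    then have desc: "1 \<le> \<alpha>" "m (Suc \<alpha>) = m \<alpha> - 1"
      using Suc.prems by (auto split: if_splits)
    then have na: "\<not> asc r m \<alpha>"
      using Suc.prems by (auto simp: asc_def)
    then have b: "?b = bt m \<alpha>" "bt m \<alpha> = Suc (bot m \<alpha>)"
      using desc Suc.prems bot_Suc[of \<alpha> r m] by (auto simp: bt_def)
    have "skel_step r m (Side ?b) (Spine ?b)" "skel_step r m (Spine ?b) (Side ?b)"
      using up_step_branch[of \<alpha>] na Suc.prems by (simp_all add: skel_step_def branch_def b(1))
    moreover have "long_wt r m ?b l (t - 1) \<in> monomials (cluster_vars r m)"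
      unfolding b(1) using Suc desc False b by (intro Suc.IH) auto
    ultimately have "skel_wt r m (Spine (Suc ?b)) (Spine ?b) t * (1 / skel_wt r m (Side ?b) (Spine ?b) t)
        * (1 / skel_wt r m (Spine ?b) (Side ?b) (t - 1)) * long_wt r m ?b l (t - 1)
        \<in> monomials (cluster_vars r m)"
      using skel by (intro monomials_intros skel_wt_monomial)
    then show ?thesis
      using False by (simp add: bt_pos)
  qed
qed simp

lemma step_wt_monomial:
  assumes "graph_step r m u v"
  shows "step_wt r m u v t \<in> monomials (cluster_vars r m)"
proof (cases "skel_step r m u v")
  case True
  then show ?thesis
    by (simp add: step_wt_def skel_wt_monomial)
next
  case False
  then show ?thesis
    using assms by (auto simp: graph_step_def step_wt_def long_edge_iff intro!: long_wt_monomial)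
qed

lemma path_wt_monomial:
  "successively (graph_step r m) vs \<Longrightarrow> path_wt r m vs t \<in> monomials (cluster_vars r m)"
  by (induction vs arbitrary: t rule: induct_list012) (auto intro!: monomials_intros step_wt_monomial)

lemma path_sum_nonneg_laurent: "nonneg_laurent (cluster_vars r m) (path_sum r m t' v t)"
  unfolding path_sum_def
  by (intro nonneg_laurent_sum finite_paths nonneg_laurent_monomial path_wt_monomial) (simp add: paths_def)

end

theorem theorem6p8:
  fixes r :: nat and m :: "nat \<Rightarrow> int" and j k :: int
  assumes "r \<ge> 1"
    and "\<And>\<alpha>. 1 \<le> \<alpha> \<Longrightarrow> \<alpha> < r \<Longrightarrow> \<bar>m (\<alpha> + 1) - m \<alpha>\<bar> \<le> 1"
    and "k \<ge> 0"
  shows "Tsol r 1 j (k + m 1) / Tsol r 1 (j + k) (m 1) = partition_function r m (j - k) (j + k)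
    \<and> nonneg_laurent (cluster_vars r m) (Tsol r 1 j (k + m 1) / Tsol r 1 (j + k) (m 1))"
proof -
  interpret motzkin r m "j + k"
    by unfold_locales (use assms in auto)
  \<comment> \<open>With final time \<open>j + k\<close>, the starting time \<open>j - k\<close>
    corresponds to \<open>n = k\<close>.\<close>
  have "Tsol r 1 j (k + m 1) / Tsol r 1 (j + k) (m 1) = path_sum r m (j + k) (Spine 0) (j - k)"
    using path_sum_root[OF assms(3)] by (simp add: add.commute)
  then show ?thesis
    by (simp add: partition_function_eq path_sum_nonneg_laurent)
qed

end
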